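(* Let $X$ and $Y$ be infinite-dimensional Banach spaces over $\mathbb{C}$, with $Y=Z'$ the dual of a normed linear space $Z$, and let $T\in B(X,Y)$. Let $(P_n)$ be a sequence in $B(X)$ with $\|P_n\|\le 1$ for each $n\in\mathbb{N}$, and suppose $T_n:=TP_n$ converges to $T$ in the weak$^*$ sense as $n\to\infty$. Then for each $k\in\mathbb{N}$, $$\lim_{n\to\infty}y_k(T_n)=y_k(T).$$
   Context: $B(X,Y)$ is the space of bounded linear operators from $X$ to $Y$ with the operator norm, $B(X)=B(X,X)$ and $X'=B(X,\mathbb{C})$. For $k\in\mathbb{N}=\{1,2,\dots\}$, $\mathcal{F}_k(X,Y)$ is the set of all finite-rank operators in $B(X,Y)$ of rank less than $k$, and the $k$-th approximation number of $T\in B(X,Y)$ is $a_k(T)=\inf\{\|T-F\| : F\in\mathcal{F}_k(X,Y)\}$. The $k$-th Chang number of $T\in B(X,Y)$ is $y_k(T)=\sup\{a_k(ST): S\in B(Y,\ell_2),\ \|S\|\le1\}$. When $Y=Z'$, a sequence $(T_n)$ in $B(X,Y)$ converges to $T$ in the weak$^*$ sense if for each $x\in X$ and $z\in Z$, $|(T_nx)(z)-(Tx)(z)|\to0$. *)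

theory Defs
  imports "HOL-Analysis.Analysis"
begin

section \<open>Complex normed spaces\<close>

text \<open>
  \<^class>\<open>real_normed_vector\<close> has real scalars only. The complex class extends it by a scalar
  multiplication that restricts to the real one and for which the norm is homogeneous.
\<close>

class complex_normed_vector = real_normed_vector +
  fixes scaleC :: "complex \<Rightarrow> 'a \<Rightarrow> 'a" (infixr "*\<^sub>C" 75)
  assumes scaleC_add_right: "a *\<^sub>C (x + y) = a *\<^sub>C x + a *\<^sub>C y"
    and scaleC_add_left: "(a + b) *\<^sub>C x = a *\<^sub>C x + b *\<^sub>C x"
    and scaleC_scaleC: "a *\<^sub>C b *\<^sub>C x = (a * b) *\<^sub>C x"
    and scaleC_of_real: "complex_of_real r *\<^sub>C x = r *\<^sub>R x"
    and norm_scaleC: "norm (a *\<^sub>C x) = cmod a * norm x"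

class complex_banach = complex_normed_vector + banach

global_interpretation complex_vector:
    vector_space "scaleC :: complex \<Rightarrow> 'a \<Rightarrow> 'a::complex_normed_vector"
  defines cdependent = complex_vector.dependent
    and crepresentation = complex_vector.representation
    and csubspace = complex_vector.subspace
    and cspan = complex_vector.span
    and cextend_basis = complex_vector.extend_basis
    and cdim = complex_vector.dim
proof
  show "1 *\<^sub>C x = x" for x :: 'a
    using scaleC_of_real[of 1 x] by simp
qed (simp_all add: scaleC_add_right scaleC_add_left scaleC_scaleC)

lemma bounded_linear_scaleC: "bounded_linear (\<lambda>x :: 'a::complex_normed_vector. c *\<^sub>C x)"
proof (rule bounded_linear_intro[where K = "cmod c"])
  show "c *\<^sub>C (r *\<^sub>R x) = r *\<^sub>R (c *\<^sub>C x)" for r and x :: 'a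
    by (simp add: scaleC_scaleC mult.commute flip: scaleC_of_real)
qed (simp_all add: scaleC_add_right norm_scaleC mult.commute)

instantiation complex :: complex_normed_vector
begin

definition scaleC_complex :: "complex \<Rightarrow> complex \<Rightarrow> complex"
  where "scaleC_complex a x = a * x"

instance
  by standard
    (simp_all add: scaleC_complex_def algebra_simps norm_mult scaleR_conv_of_real)

end

instance complex :: complex_banach ..

text \<open>
  For a subspace \<open>V\<close> this says that \<open>V\<close> has finite dimension. It is needed separately because
  \<^const>\<open>cdim\<close> is \<open>0\<close> on infinite-dimensional spaces.
\<close>

definition finite_cdim :: "'a::complex_normed_vector set \<Rightarrow> bool"
  where "finite_cdim V \<longleftrightarrow> (\<exists>B. finite B \<and> V \<subseteq> cspan B)"


section \<open>Bounded complex-linear operators\<close>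

typedef (overloaded) ('a, 'b) cblinfun ("(_ \<Rightarrow>\<^sub>C\<^sub>L /_)" [22, 21] 21) =
    "{f :: 'a::complex_normed_vector \<Rightarrow>\<^sub>L 'b::complex_normed_vector.
        \<forall>c x. blinfun_apply f (c *\<^sub>C x) = c *\<^sub>C blinfun_apply f x}"
  morphisms blinfun_of_cblinfun CBlinfun
  by (rule exI[of _ 0]) (simp add: complex_vector.scale_zero_right)

setup_lifting type_definition_cblinfun

lift_definition cblinfun_apply ::
    "'a::complex_normed_vector \<Rightarrow>\<^sub>C\<^sub>L 'b::complex_normed_vector \<Rightarrow> 'a \<Rightarrow> 'b"
  is blinfun_apply .

lift_definition cblinfun_compose ::
    "'b::complex_normed_vector \<Rightarrow>\<^sub>C\<^sub>L 'c::complex_normed_vector \<Rightarrow>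
     'a::complex_normed_vector \<Rightarrow>\<^sub>C\<^sub>L 'b \<Rightarrow> 'a \<Rightarrow>\<^sub>C\<^sub>L 'c" (infixl "o\<^sub>C" 55)
  is blinfun_compose
  by simp

lemma cblinfun_eqI: "(\<And>x. cblinfun_apply f x = cblinfun_apply g x) \<Longrightarrow> f = g"
  by transfer (rule blinfun_eqI)

lemma cblinfun_apply_compose [simp]:
  "cblinfun_apply (S o\<^sub>C T) x = cblinfun_apply S (cblinfun_apply T x)"
  by transfer simp

instantiation cblinfun :: (complex_normed_vector, complex_normed_vector) complex_normed_vector
begin

lift_definition zero_cblinfun :: "'a \<Rightarrow>\<^sub>C\<^sub>L 'b" is 0
  by (simp add: complex_vector.scale_zero_right)

lift_definition plus_cblinfun :: "'a \<Rightarrow>\<^sub>C\<^sub>L 'b \<Rightarrow> 'a \<Rightarrow>\<^sub>C\<^sub>L 'b \<Rightarrow> 'a \<Rightarrow>\<^sub>C\<^sub>L 'b" is "(+)"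
  by (simp add: plus_blinfun.rep_eq scaleC_add_right)

lift_definition uminus_cblinfun :: "'a \<Rightarrow>\<^sub>C\<^sub>L 'b \<Rightarrow> 'a \<Rightarrow>\<^sub>C\<^sub>L 'b" is uminus
  by (simp add: uminus_blinfun.rep_eq complex_vector.scale_minus_right)

lift_definition minus_cblinfun :: "'a \<Rightarrow>\<^sub>C\<^sub>L 'b \<Rightarrow> 'a \<Rightarrow>\<^sub>C\<^sub>L 'b \<Rightarrow> 'a \<Rightarrow>\<^sub>C\<^sub>L 'b" is "(-)"
  by (simp add: minus_blinfun.rep_eq complex_vector.scale_right_diff_distrib)

lift_definition scaleR_cblinfun :: "real \<Rightarrow> 'a \<Rightarrow>\<^sub>C\<^sub>L 'b \<Rightarrow> 'a \<Rightarrow>\<^sub>C\<^sub>L 'b" is scaleR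
  by (simp add: scaleR_blinfun.rep_eq scaleC_scaleC mult.commute flip: scaleC_of_real)

lift_definition scaleC_cblinfun :: "complex \<Rightarrow> 'a \<Rightarrow>\<^sub>C\<^sub>L 'b \<Rightarrow> 'a \<Rightarrow>\<^sub>C\<^sub>L 'b"
  is "\<lambda>c f. Blinfun (\<lambda>x. c *\<^sub>C blinfun_apply f x)"
  by (subst (1 2) bounded_linear_Blinfun_apply)
    (auto intro!: bounded_linear_compose[OF bounded_linear_scaleC] blinfun.bounded_linear_right
      simp: scaleC_scaleC mult.commute)

text \<open>The norm of \<^typ>\<open>'a \<Rightarrow>\<^sub>L 'b\<close> is the operator norm.\<close>

lift_definition norm_cblinfun :: "'a \<Rightarrow>\<^sub>C\<^sub>L 'b \<Rightarrow> real" is norm .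

definition sgn_cblinfun :: "'a \<Rightarrow>\<^sub>C\<^sub>L 'b \<Rightarrow> 'a \<Rightarrow>\<^sub>C\<^sub>L 'b"
  where "sgn_cblinfun f = inverse (norm f) *\<^sub>R f"

definition dist_cblinfun :: "'a \<Rightarrow>\<^sub>C\<^sub>L 'b \<Rightarrow> 'a \<Rightarrow>\<^sub>C\<^sub>L 'b \<Rightarrow> real"
  where "dist_cblinfun f g = norm (f - g)"

definition uniformity_cblinfun :: "(('a \<Rightarrow>\<^sub>C\<^sub>L 'b) \<times> ('a \<Rightarrow>\<^sub>C\<^sub>L 'b)) filter"
  where "uniformity_cblinfun = (INF e\<in>{0<..}. principal {(f, g). dist f g < e})"

definition open_cblinfun :: "('a \<Rightarrow>\<^sub>C\<^sub>L 'b) set \<Rightarrow> bool"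
  where "open_cblinfun U \<longleftrightarrow> (\<forall>f\<in>U. \<forall>\<^sub>F (f', g) in uniformity. f' = f \<longrightarrow> g \<in> U)"

lemma blinfun_apply_scaleC_cblinfun:
  "blinfun_apply (blinfun_of_cblinfun (c *\<^sub>C f)) x = c *\<^sub>C blinfun_apply (blinfun_of_cblinfun f) x"
  by (simp add: scaleC_cblinfun.rep_eq bounded_linear_Blinfun_apply
      bounded_linear_compose[OF bounded_linear_scaleC] blinfun.bounded_linear_right)

instance
proof
  fix f g h :: "'a \<Rightarrow>\<^sub>C\<^sub>L 'b" and c d :: complex and r s :: real
  show "f + g + h = f + (g + h)" "f + g = g + f" "0 + f = f" "- f + f = 0" "f - g = f + - g"
    by (transfer; simp)+
  show "r *\<^sub>R (f + g) = r *\<^sub>R f + r *\<^sub>R g" "(r + s) *\<^sub>R f = r *\<^sub>R f + s *\<^sub>R f"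
    "r *\<^sub>R s *\<^sub>R f = (r * s) *\<^sub>R f" "1 *\<^sub>R f = f"
    by (transfer; simp add: scaleR_add_left scaleR_add_right)+
  show "norm f = 0 \<longleftrightarrow> f = 0" "norm (f + g) \<le> norm f + norm g" "norm (r *\<^sub>R f) = \<bar>r\<bar> * norm f"
    by (transfer; simp add: norm_triangle_ineq)+
  show "sgn f = inverse (norm f) *\<^sub>R f" by (rule sgn_cblinfun_def)
  show "dist f g = norm (f - g)" by (rule dist_cblinfun_def)
  show "(uniformity :: (('a \<Rightarrow>\<^sub>C\<^sub>L 'b) \<times> ('a \<Rightarrow>\<^sub>C\<^sub>L 'b)) filter) =
      (INF e\<in>{0<..}. principal {(f, g). dist f g < e})"
    by (rule uniformity_cblinfun_def)
  show "open U \<longleftrightarrow> (\<forall>f\<in>U. \<forall>\<^sub>F (f', g) in uniformity. f' = f \<longrightarrow> g \<in> U)" for U :: "('a \<Rightarrow>\<^sub>C\<^sub>L 'b) set"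
    by (rule open_cblinfun_def)
  note app = cblinfun_apply.rep_eq plus_cblinfun.rep_eq scaleR_cblinfun.rep_eq
    blinfun_apply_scaleC_cblinfun blinfun.add_left blinfun.scaleR_left
  show "c *\<^sub>C (f + g) = c *\<^sub>C f + c *\<^sub>C g" "(c + d) *\<^sub>C f = c *\<^sub>C f + d *\<^sub>C f"
    "c *\<^sub>C d *\<^sub>C f = (c * d) *\<^sub>C f" "complex_of_real r *\<^sub>C f = r *\<^sub>R f"
    by (rule cblinfun_eqI, simp add: app scaleC_add_left scaleC_add_right scaleC_scaleC scaleC_of_real)+
  have le: "norm (a *\<^sub>C u) \<le> cmod a * norm u" for a and u :: "'a \<Rightarrow>\<^sub>C\<^sub>L 'b"
    unfolding norm_cblinfun.rep_eq
    by (rule norm_blinfun_bound)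
      (auto simp: blinfun_apply_scaleC_cblinfun norm_scaleC mult.assoc norm_blinfun intro!: mult_left_mono)
  show "norm (c *\<^sub>C f) = cmod c * norm f"
  proof (cases "c = 0")
    case True
    have "0 *\<^sub>C f = 0"
      by (rule cblinfun_eqI) (simp add: app zero_cblinfun.rep_eq complex_vector.scale_zero_left)
    then show ?thesis
      using True by (simp add: norm_cblinfun.rep_eq zero_cblinfun.rep_eq)
  next
    case False
    have "inverse c *\<^sub>C c *\<^sub>C f = f"
      using False by (intro cblinfun_eqI) (simp add: app scaleC_scaleC complex_vector.scale_one)
    then have "norm f \<le> cmod (inverse c) * norm (c *\<^sub>C f)"
      using le[of "inverse c" "c *\<^sub>C f"] by simp
    then have "cmod c * norm f \<le> norm (c *\<^sub>C f)"
      using False by (simp add: norm_inverse norm_divide field_simps)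
    with le[of c f] show ?thesis by simp
  qed
qed

end

instance cblinfun :: (complex_normed_vector, complex_banach) complex_banach
proof
  fix X :: "nat \<Rightarrow> 'a \<Rightarrow>\<^sub>C\<^sub>L 'b"
  assume X: "Cauchy X"
  have dist_eq: "dist f g = dist (blinfun_of_cblinfun f) (blinfun_of_cblinfun g)" for f g :: "'a \<Rightarrow>\<^sub>C\<^sub>L 'b"
    by (simp add: dist_cblinfun_def dist_norm norm_cblinfun.rep_eq minus_cblinfun.rep_eq)
  from X have "Cauchy (\<lambda>n. blinfun_of_cblinfun (X n))"
    unfolding Cauchy_def dist_eq .
  then obtain L where L: "(\<lambda>n. blinfun_of_cblinfun (X n)) \<longlonglongrightarrow> L"
    using Cauchy_convergent convergent_def by blast
  have lim: "(\<lambda>n. blinfun_apply (blinfun_of_cblinfun (X n)) x) \<longlonglongrightarrow> blinfun_apply L x" for x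
    by (intro blinfun.tendsto L tendsto_const)
  have "blinfun_apply L (c *\<^sub>C x) = c *\<^sub>C blinfun_apply L x" for c x
  proof (rule LIMSEQ_unique[OF lim])
    have "blinfun_apply (blinfun_of_cblinfun (X n)) (c *\<^sub>C x) = c *\<^sub>C blinfun_apply (blinfun_of_cblinfun (X n)) x" for n
      using blinfun_of_cblinfun[of "X n"] by simp
    then show "(\<lambda>n. blinfun_apply (blinfun_of_cblinfun (X n)) (c *\<^sub>C x)) \<longlonglongrightarrow> c *\<^sub>C blinfun_apply L x"
      using bounded_linear.tendsto[OF bounded_linear_scaleC lim] by simp
  qed
  then have "blinfun_of_cblinfun (CBlinfun L) = L"
    by (simp add: CBlinfun_inverse)
  with L have "X \<longlonglongrightarrow> CBlinfun L"
    by (simp add: tendsto_iff dist_eq)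
  then show "convergent X"
    by (auto simp: convergent_def)
qed

lemma norm_cblinfun_compose: "norm (S o\<^sub>C T) \<le> norm S * norm T"
  by transfer (rule norm_blinfun_compose)

type_synonym 'a dual = "'a \<Rightarrow>\<^sub>C\<^sub>L complex"


section \<open>The Hilbert space of square-summable sequences\<close>

typedef ell2 = "{x :: nat \<Rightarrow> complex. summable (\<lambda>i. (cmod (x i))\<^sup>2)}"
  morphisms ell2_nth Ell2
  by (rule exI[of _ "\<lambda>_. 0"]) simp

setup_lifting type_definition_ell2

lemma summable_cmod_add_power2:
  fixes x y :: "nat \<Rightarrow> complex"
  assumes "summable (\<lambda>i. (cmod (x i))\<^sup>2)" "summable (\<lambda>i. (cmod (y i))\<^sup>2)"
  shows "summable (\<lambda>i. (cmod (x i + y i))\<^sup>2)"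
proof (rule summable_comparison_test')
  show "summable (\<lambda>i. 2 * (cmod (x i))\<^sup>2 + 2 * (cmod (y i))\<^sup>2)"
    using assms by (intro summable_add summable_mult)
  show "norm ((cmod (x i + y i))\<^sup>2) \<le> 2 * (cmod (x i))\<^sup>2 + 2 * (cmod (y i))\<^sup>2" for i
  proof -
    have "(cmod (x i + y i))\<^sup>2 \<le> (cmod (x i) + cmod (y i))\<^sup>2"
      by (intro power_mono norm_triangle_ineq) simp
    also have "\<dots> \<le> 2 * (cmod (x i))\<^sup>2 + 2 * (cmod (y i))\<^sup>2"
      using zero_le_power2[of "cmod (x i) - cmod (y i)"] by (simp add: power2_eq_square algebra_simps)
    finally show ?thesis by simp
  qed
qed

lemma sqrt_suminf_triangle:
  fixes x y :: "nat \<Rightarrow> complex"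
  assumes x: "summable (\<lambda>i. (cmod (x i))\<^sup>2)" and y: "summable (\<lambda>i. (cmod (y i))\<^sup>2)"
  shows "sqrt (\<Sum>i. (cmod (x i + y i))\<^sup>2) \<le> sqrt (\<Sum>i. (cmod (x i))\<^sup>2) + sqrt (\<Sum>i. (cmod (y i))\<^sup>2)"
proof (rule LIMSEQ_le_const2)
  show "(\<lambda>n. sqrt (\<Sum>i<n. (cmod (x i + y i))\<^sup>2)) \<longlonglongrightarrow> sqrt (\<Sum>i. (cmod (x i + y i))\<^sup>2)"
    by (intro tendsto_real_sqrt summable_LIMSEQ summable_cmod_add_power2 x y)
  have "sqrt (\<Sum>i<n. (cmod (x i + y i))\<^sup>2) \<le> sqrt (\<Sum>i. (cmod (x i))\<^sup>2) + sqrt (\<Sum>i. (cmod (y i))\<^sup>2)" for n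
  proof -
    have "sqrt (\<Sum>i<n. (cmod (x i + y i))\<^sup>2) \<le> L2_set (\<lambda>i. cmod (x i) + cmod (y i)) {..<n}"
      unfolding L2_set_def by (intro real_sqrt_le_mono sum_mono power_mono norm_triangle_ineq) simp
    also have "\<dots> \<le> L2_set (\<lambda>i. cmod (x i)) {..<n} + L2_set (\<lambda>i. cmod (y i)) {..<n}"
      by (rule L2_set_triangle_ineq)
    also have "\<dots> \<le> sqrt (\<Sum>i. (cmod (x i))\<^sup>2) + sqrt (\<Sum>i. (cmod (y i))\<^sup>2)"
      unfolding L2_set_def by (intro add_mono real_sqrt_le_mono sum_le_suminf x y) auto
    finally show ?thesis .
  qed
  then show "\<exists>N. \<forall>n\<ge>N. sqrt (\<Sum>i<n. (cmod (x i + y i))\<^sup>2)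
      \<le> sqrt (\<Sum>i. (cmod (x i))\<^sup>2) + sqrt (\<Sum>i. (cmod (y i))\<^sup>2)"
    by blast
qed

lemma ell2_eqI: "(\<And>i. ell2_nth x i = ell2_nth y i) \<Longrightarrow> x = y"
  by transfer auto

instantiation ell2 :: complex_normed_vector
begin

lift_definition zero_ell2 :: ell2 is "\<lambda>_. 0"
  by simp

lift_definition plus_ell2 :: "ell2 \<Rightarrow> ell2 \<Rightarrow> ell2" is "\<lambda>x y i. x i + y i"
  by (rule summable_cmod_add_power2)

lift_definition uminus_ell2 :: "ell2 \<Rightarrow> ell2" is "\<lambda>x i. - x i"
  by simp

lift_definition minus_ell2 :: "ell2 \<Rightarrow> ell2 \<Rightarrow> ell2" is "\<lambda>x y i. x i - y i"
  using summable_cmod_add_power2[of _ "\<lambda>i. - _ i"] by simp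

lift_definition scaleC_ell2 :: "complex \<Rightarrow> ell2 \<Rightarrow> ell2" is "\<lambda>c x i. c * x i"
  by (simp add: norm_mult power_mult_distrib summable_mult)

lift_definition scaleR_ell2 :: "real \<Rightarrow> ell2 \<Rightarrow> ell2" is "\<lambda>r x i. r *\<^sub>R x i"
  by (simp add: power_mult_distrib summable_mult)

lift_definition norm_ell2 :: "ell2 \<Rightarrow> real" is "\<lambda>x. sqrt (\<Sum>i. (cmod (x i))\<^sup>2)" .

definition sgn_ell2 :: "ell2 \<Rightarrow> ell2"
  where "sgn_ell2 x = inverse (norm x) *\<^sub>R x"

definition dist_ell2 :: "ell2 \<Rightarrow> ell2 \<Rightarrow> real"
  where "dist_ell2 x y = norm (x - y)"

definition uniformity_ell2 :: "(ell2 \<times> ell2) filter"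
  where "uniformity_ell2 = (INF e\<in>{0<..}. principal {(x, y). dist x y < e})"

definition open_ell2 :: "ell2 set \<Rightarrow> bool"
  where "open_ell2 U \<longleftrightarrow> (\<forall>x\<in>U. \<forall>\<^sub>F (x', y) in uniformity. x' = x \<longrightarrow> y \<in> U)"

instance
proof
  fix x y z :: ell2 and c d :: complex and r s :: real
  show "x + y + z = x + (y + z)" "x + y = y + x" "0 + x = x" "- x + x = 0" "x - y = x + - y"
    by (transfer; simp add: ac_simps)+
  show "r *\<^sub>R (x + y) = r *\<^sub>R x + r *\<^sub>R y" "(r + s) *\<^sub>R x = r *\<^sub>R x + s *\<^sub>R x"
    "r *\<^sub>R s *\<^sub>R x = (r * s) *\<^sub>R x" "1 *\<^sub>R x = x"
    by (transfer; simp add: scaleR_add_left scaleR_add_right)+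
  show "c *\<^sub>C (x + y) = c *\<^sub>C x + c *\<^sub>C y" "(c + d) *\<^sub>C x = c *\<^sub>C x + d *\<^sub>C x"
    "c *\<^sub>C d *\<^sub>C x = (c * d) *\<^sub>C x" "complex_of_real r *\<^sub>C x = r *\<^sub>R x"
    by (transfer; simp add: algebra_simps scaleR_conv_of_real)+
  show "norm x = 0 \<longleftrightarrow> x = 0"
    by transfer (auto simp: suminf_eq_zero_iff)
  show "norm (x + y) \<le> norm x + norm y"
    by transfer (rule sqrt_suminf_triangle)
  show "norm (r *\<^sub>R x) = \<bar>r\<bar> * norm x"
    by transfer (simp add: power_mult_distrib suminf_mult real_sqrt_mult)
  show "norm (c *\<^sub>C x) = cmod c * norm x"
    by transfer (simp add: norm_mult power_mult_distrib suminf_mult real_sqrt_mult)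
  show "sgn x = inverse (norm x) *\<^sub>R x" by (rule sgn_ell2_def)
  show "dist x y = norm (x - y)" by (rule dist_ell2_def)
  show "(uniformity :: (ell2 \<times> ell2) filter) = (INF e\<in>{0<..}. principal {(x, y). dist x y < e})"
    by (rule uniformity_ell2_def)
  show "open U \<longleftrightarrow> (\<forall>x\<in>U. \<forall>\<^sub>F (x', y) in uniformity. x' = x \<longrightarrow> y \<in> U)" for U :: "ell2 set"
    by (rule open_ell2_def)
qed

end


section \<open>Approximation numbers and Chang numbers\<close>

definition finite_rank_less ::
    "nat \<Rightarrow> ('a::complex_normed_vector \<Rightarrow>\<^sub>C\<^sub>L 'b::complex_normed_vector) set"
  where "finite_rank_less k =
    {F. finite_cdim (range (cblinfun_apply F)) \<and> cdim (range (cblinfun_apply F)) < k}"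

definition approx_number ::
    "nat \<Rightarrow> 'a::complex_normed_vector \<Rightarrow>\<^sub>C\<^sub>L 'b::complex_normed_vector \<Rightarrow> real"
  where "approx_number k T = (INF F\<in>finite_rank_less k. norm (T - F))"

definition chang_number ::
    "nat \<Rightarrow> 'a::complex_normed_vector \<Rightarrow>\<^sub>C\<^sub>L 'b::complex_normed_vector \<Rightarrow> real"
  where "chang_number k T = (SUP S\<in>{S :: 'b \<Rightarrow>\<^sub>C\<^sub>L ell2. norm S \<le> 1}. approx_number k (S o\<^sub>C T))"

text \<open>
  Infima and suprema over the empty set or over unbounded sets of reals are unspecified. For
  \<open>k \<ge> 1\<close> the following facts exclude this.
\<close>

lemma zero_in_finite_rank_less:
  assumes "k \<ge> 1"
  shows "(0 :: 'a::complex_normed_vector \<Rightarrow>\<^sub>C\<^sub>L 'b::complex_normed_vector) \<in> finite_rank_less k"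
proof -
  have "range (cblinfun_apply (0 :: 'a \<Rightarrow>\<^sub>C\<^sub>L 'b)) = {0}"
    by (auto simp: cblinfun_apply.rep_eq zero_cblinfun.rep_eq)
  moreover have "cspan {0 :: 'b} = cspan {}" "cdim {0 :: 'b} = 0"
    using complex_vector.dim_eq_card[of "{}" "{0 :: 'b}"]
    by (simp_all add: complex_vector.independent_empty)
  ultimately show ?thesis
    using assms by (auto simp: finite_rank_less_def finite_cdim_def intro!: exI[of _ "{}"])
qed

lemma approx_number_nonneg: "k \<ge> 1 \<Longrightarrow> 0 \<le> approx_number k T"
  unfolding approx_number_def using zero_in_finite_rank_less by (intro cINF_greatest) auto

lemma approx_number_le_norm: "k \<ge> 1 \<Longrightarrow> approx_number k T \<le> norm T"
  unfolding approx_number_def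
  by (rule cINF_lower2[OF _ zero_in_finite_rank_less]) (auto intro: bdd_belowI[of _ 0])

lemma bdd_above_chang_number:
  fixes T :: "'a::complex_normed_vector \<Rightarrow>\<^sub>C\<^sub>L 'b::complex_normed_vector"
  assumes "k \<ge> 1"
  shows "bdd_above ((\<lambda>S. approx_number k (S o\<^sub>C T)) ` {S :: 'b \<Rightarrow>\<^sub>C\<^sub>L ell2. norm S \<le> 1})"
proof (rule bdd_aboveI2)
  fix S :: "'b \<Rightarrow>\<^sub>C\<^sub>L ell2"
  assume "S \<in> {S. norm S \<le> 1}"
  then have "norm (S o\<^sub>C T) \<le> norm T"
    using norm_cblinfun_compose[of S T] mult_right_mono[of "norm S" 1 "norm T"] by simp
  then show "approx_number k (S o\<^sub>C T) \<le> norm T"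
    using approx_number_le_norm[OF assms, of "S o\<^sub>C T"] by simp
qed


section \<open>Weak-star convergence\<close>

definition weak_star_convergent ::
    "(nat \<Rightarrow> 'a::complex_normed_vector \<Rightarrow>\<^sub>C\<^sub>L 'z::complex_normed_vector dual) \<Rightarrow>
     'a \<Rightarrow>\<^sub>C\<^sub>L 'z dual \<Rightarrow> bool"
  where "weak_star_convergent T T0 \<longleftrightarrow>
    (\<forall>x z. (\<lambda>n. cmod (cblinfun_apply (cblinfun_apply (T n) x) z
                     - cblinfun_apply (cblinfun_apply T0 x) z)) \<longlonglongrightarrow> 0)"

end

theory Submission
  imports Defs "HOL-Library.Function_Algebras"
begin

text \<open>
  Composition with \<open>P n\<close> does not increase Chang numbers, so only lower semicontinuity is at stake.
  An operator \<open>S\<close> from the dual of \<open>Z\<close> to \<open>\<ell>\<^sub>2\<close> need not be weak-star continuous, but on finitely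
  many functionals its first \<open>m\<close> coordinates are approximated by evaluations at points \<open>z\<^sub>i\<close> of \<open>Z\<close>
  whose joint norm is still at most 1 (a form of local reflexivity, from Hahn--Banach and a finite
  net of the ball of \<open>\<complex>\<^sup>m\<close>). For the resulting weak-star continuous operators, \<open>T P\<^sub>n \<rightarrow> T\<close> becomes
  coordinatewise convergence. Finally, approximation numbers of operators into \<open>\<ell>\<^sub>2\<close> are determined
  by finitely many vectors and coordinates at a time: approximants of rank less than \<open>k\<close> fitting
  ever more finite data have a pointwise limit, by Tychonoff's theorem, and the limit again has rank
  less than \<open>k\<close>.
\<close>

section \<open>Sublinear functionals\<close>

definition sublinear :: "('v::real_vector \<Rightarrow> real) \<Rightarrow> bool"
  where "sublinear q \<longleftrightarrow>
    (\<forall>x y. q (x + y) \<le> q x + q y) \<and> (\<forall>t\<ge>0. \<forall>x. q (t *\<^sub>R x) = t * q x)"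

lemma sublinear_add: "sublinear q \<Longrightarrow> q (x + y) \<le> q x + q y"
  and sublinear_scaleR: "sublinear q \<Longrightarrow> t \<ge> 0 \<Longrightarrow> q (t *\<^sub>R x) = t * q x"
  by (auto simp: sublinear_def)

lemma sublinear_0: "sublinear q \<Longrightarrow> q 0 = 0"
  using sublinear_scaleR[of q 0 0] by simp

lemma sublinear_minus_le: "sublinear q \<Longrightarrow> - q (- x) \<le> q x"
  using sublinear_add[of q x "- x"] sublinear_0[of q] by simp

text \<open>
  Used twice: with \<open>D = {y}\<close> and \<open>\<beta> = q y\<close> it shows that a minimal sublinear functional is odd, hence
  linear; with a general \<open>D\<close> it turns Hahn--Banach domination into separation.
\<close>

lemma sublinear_shrink:
  fixes q :: "'v::real_vector \<Rightarrow> real"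
  assumes q: "sublinear q" and D: "convex D" "D \<noteq> {}" and \<beta>: "\<And>d. d \<in> D \<Longrightarrow> \<beta> \<le> q d"
  obtains p where "sublinear p" "p \<le> q" "\<And>d. d \<in> D \<Longrightarrow> p (- d) \<le> - \<beta>"
proof -
  \<comment> \<open>Any sublinear \<open>p \<le> q\<close> with
    \<open>p (- d) \<le> - \<beta>\<close> on \<open>D\<close> satisfies
    \<open>p x \<le> q (x + t *\<^sub>R d) - t * \<beta>\<close>. The infimum of these bounds is the
    largest candidate.\<close>
  define h where "h x u = q (x + fst u *\<^sub>R snd u) - fst u * \<beta>" for x and u :: "real \<times> 'v"
  define U where "U = {0::real..} \<times> D"
  define p where "p x = (INF u\<in>U. h x u)" for x
  have U: "U \<noteq> {}" using D by (auto simp: U_def)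
  have lower: "- q (- x) \<le> h x u" if "u \<in> U" for x u
  proof -
    from that obtain t d where u: "u = (t, d)" "t \<ge> 0" "d \<in> D" by (auto simp: U_def)
    have "q (t *\<^sub>R d) \<le> q (x + t *\<^sub>R d) + q (- x)"
      using sublinear_add[OF q, of "x + t *\<^sub>R d" "- x"] by simp
    moreover have "t * \<beta> \<le> q (t *\<^sub>R d)"
      using \<beta>[of d] u by (simp add: sublinear_scaleR[OF q] mult_left_mono)
    ultimately show ?thesis by (simp add: h_def u)
  qed
  have bdd: "bdd_below (h x ` U)" for x
    by (rule bdd_belowI2[OF lower])
  have p_le: "p x \<le> h x u" if "u \<in> U" for x u
    unfolding p_def by (rule cINF_lower[OF bdd that])
  have p_ge: "a \<le> p x" if "\<And>u. u \<in> U \<Longrightarrow> a \<le> h x u" for a x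
    unfolding p_def by (rule cINF_greatest[OF U that])
  obtain d0 where d0: "d0 \<in> D" using D by blast
  have p_le_q: "p x \<le> q x" for x
    using p_le[of "(0, d0)" x] d0 by (simp add: U_def h_def)
  have add: "p (x + y) \<le> p x + p y" for x y
  proof -
    have *: "p (x + y) \<le> h x u + h y v" if uv: "u \<in> U" "v \<in> U" for u v
    proof -
      obtain t d s e where u: "u = (t, d)" "t \<ge> 0" "d \<in> D" and v: "v = (s, e)" "s \<ge> 0" "e \<in> D"
        using uv by (auto simp: U_def)
      \<comment> \<open>Convexity enters here: the two shifts merge into one of length
        \<open>t + s\<close> along the weighted mean of \<open>d\<close> and \<open>e\<close>. When
        both lengths are 0 any point of \<open>D\<close> will do.\<close>
      define c where "c = (if t + s = 0 then d else (t / (t + s)) *\<^sub>R d + (s / (t + s)) *\<^sub>R e)"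
      have c: "c \<in> D" and ts: "(t + s) *\<^sub>R c = t *\<^sub>R d + s *\<^sub>R e"
        using u v D(1) by (auto simp: c_def scaleR_add_right add_divide_distrib[symmetric]
            add_nonneg_eq_0_iff intro!: convexD)
      have sum_eq: "x + y + (t + s) *\<^sub>R c = (x + t *\<^sub>R d) + (y + s *\<^sub>R e)"
        by (simp only: ts) (simp add: algebra_simps)
      have "p (x + y) \<le> h (x + y) (t + s, c)"
        using c u v by (intro p_le) (auto simp: U_def)
      also have "\<dots> = q ((x + t *\<^sub>R d) + (y + s *\<^sub>R e)) - (t + s) * \<beta>"
        by (simp add: h_def sum_eq)
      also have "\<dots> \<le> h x u + h y v"
        using sublinear_add[OF q, of "x + t *\<^sub>R d" "y + s *\<^sub>R e"]
        by (simp add: h_def u v algebra_simps)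
      finally show ?thesis .
    qed
    have "p (x + y) - h y v \<le> p x" if "v \<in> U" for v
      using *[OF _ that] by (intro p_ge) (simp add: algebra_simps)
    then have "p (x + y) - p x \<le> p y"
      by (intro p_ge) (simp add: algebra_simps)
    then show ?thesis by simp
  qed
  have scale_le: "p (r *\<^sub>R x) \<le> r * p x" if "r > 0" for r x
  proof -
    have "p (r *\<^sub>R x) / r \<le> p x"
    proof (rule p_ge)
      fix u assume "u \<in> U"
      then obtain t d where u: "u = (t, d)" "t \<ge> 0" "d \<in> D" by (auto simp: U_def)
      have "p (r *\<^sub>R x) \<le> h (r *\<^sub>R x) (r * t, d)"
        using u that by (intro p_le) (auto simp: U_def)
      also have "\<dots> = q (r *\<^sub>R (x + t *\<^sub>R d)) - r * t * \<beta>"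
        by (simp add: h_def scaleR_add_right)
      also have "\<dots> = r * h x u"
        using that by (simp only: sublinear_scaleR[OF q] less_imp_le) (simp add: h_def u algebra_simps)
      finally show "p (r *\<^sub>R x) / r \<le> h x u"
        using that by (simp add: field_simps)
    qed
    then show ?thesis using that by (simp add: field_simps)
  qed
  have scale: "p (r *\<^sub>R x) = r * p x" if "r \<ge> 0" for r x
  proof (cases "r = 0")
    case True
    have "p 0 = 0"
      using p_le_q[of 0] p_ge[of 0 0] lower[of _ 0] sublinear_0[OF q] by fastforce
    then show ?thesis using True by simp
  next
    case False
    then have r: "r > 0" using that by simp
    have "p (inverse r *\<^sub>R r *\<^sub>R x) \<le> inverse r * p (r *\<^sub>R x)"
      using r by (intro scale_le) simp
    then have "r * p x \<le> p (r *\<^sub>R x)"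
      using r by (simp add: field_simps)
    with scale_le[OF r, of x] show ?thesis by simp
  qed
  show thesis
  proof
    show "sublinear p" using add scale by (simp add: sublinear_def)
    show "p \<le> q" using p_le_q by (simp add: le_fun_def)
    show "p (- d) \<le> - \<beta>" if "d \<in> D" for d
      using p_le[of "(1, d)" "- d"] that by (simp add: U_def h_def sublinear_0[OF q])
  qed
qed

text \<open>Zorn's lemma in the reversed pointwise order gives a minimal sublinear functional below
  \<open>q\<close>. By \<open>sublinear_shrink\<close> it is odd, hence linear.\<close>

lemma hahn_banach_sublinear:
  fixes q :: "'v::real_vector \<Rightarrow> real"
  assumes q: "sublinear q"
  obtains f where "linear f" "f \<le> q"
proof -
  define A where "A = {p. sublinear p \<and> p \<le> q}"
  have "\<exists>m\<in>A. \<forall>a\<in>A. a \<le> m \<longrightarrow> a = m"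
  proof (rule predicate_Zorn)
    show "partial_order_on A (relation_of (\<lambda>a b. b \<le> a) A)"
      by (rule partial_order_on_relation_ofI) auto
    fix C assume C: "C \<in> Chains (relation_of (\<lambda>a b. b \<le> a) A)"
    show "\<exists>u\<in>A. \<forall>a\<in>C. u \<le> a"
    proof (cases "C = {}")
      case True
      then show ?thesis using q by (auto simp: A_def)
    next
      case False
      have CA: "a \<in> A" if "a \<in> C" for a
        using C that by (auto simp: Chains_def relation_of_def)
      have total: "a \<le> b \<or> b \<le> a" if "a \<in> C" "b \<in> C" for a b
        using C that by (auto simp: Chains_def relation_of_def)
      define u where "u x = (INF a\<in>C. a x)" for x
      \<comment> \<open>This bound is independent of \<open>a\<close>, so the infimum over the chain
        is finite.\<close>
      have "- q (- x) \<le> a x" if "a \<in> C" for a x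
      proof -
        have "sublinear a" "a (- x) \<le> q (- x)"
          using CA[OF that] by (auto simp: A_def le_fun_def)
        then show ?thesis using sublinear_minus_le[of a x] by simp
      qed
      then have bdd: "bdd_below ((\<lambda>a. a x) ` C)" for x
        by (rule bdd_belowI2)
      have u_le: "u x \<le> a x" if "a \<in> C" for a x
        unfolding u_def by (rule cINF_lower[OF bdd that])
      have u_ge: "r \<le> u x" if "\<And>a. a \<in> C \<Longrightarrow> r \<le> a x" for r x
        unfolding u_def by (rule cINF_greatest[OF False that])
      have "u (x + y) \<le> u x + u y" for x y
      proof -
        \<comment> \<open>Two members of a chain are comparable, and the smaller one serves for both
          summands.\<close>
        have *: "u (x + y) \<le> a x + b y" if ab: "a \<in> C" "b \<in> C" for a b
        proof -
          have "u (x + y) \<le> c x + c y" if "c \<in> C" for c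
            using u_le[OF that, of "x + y"] sublinear_add[of c x y] CA[OF that] by (simp add: A_def)
          then show ?thesis
            using total[OF ab] ab by (smt (verit) le_fun_def)
        qed
        have "u (x + y) - b y \<le> u x" if "b \<in> C" for b
          using *[OF _ that] by (intro u_ge) (simp add: algebra_simps)
        then have "u (x + y) - u x \<le> u y"
          by (intro u_ge) (simp add: algebra_simps)
        then show ?thesis by simp
      qed
      moreover have "u (t *\<^sub>R x) = t * u x" if "t \<ge> 0" for t x
      proof -
        have eq: "a (t *\<^sub>R x) = t * a x" if "a \<in> C" for a
          using CA[OF that] \<open>t \<ge> 0\<close> by (simp add: A_def sublinear_scaleR)
        show ?thesis
        proof (cases "t = 0")
          case True
          have "(INF a\<in>C. a (0::'v)) = (INF a\<in>C. 0)"
            using CA by (intro INF_cong) (auto simp: A_def sublinear_0)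
          then show ?thesis using True False by (simp add: u_def)
        next
          case t: False
          then have "t > 0" using that by simp
          have "u (t *\<^sub>R x) / t \<le> u x"
            using u_le[of _ "t *\<^sub>R x"] eq \<open>t > 0\<close> by (intro u_ge) (simp add: field_simps)
          moreover have "t * u x \<le> u (t *\<^sub>R x)"
          proof (rule u_ge)
            fix a assume "a \<in> C"
            then show "t * u x \<le> a (t *\<^sub>R x)"
              using u_le[of a x] \<open>t > 0\<close> by (subst eq) simp_all
          qed
          ultimately show ?thesis using \<open>t > 0\<close> by (simp add: field_simps)
        qed
      qed
      ultimately have "sublinear u" by (simp add: sublinear_def)
      moreover have "u \<le> q"
      proof -
        obtain a where a: "a \<in> C" using False by blast
        have "u \<le> a" using u_le[OF a] by (simp add: le_fun_def)
        also have "a \<le> q" using CA[OF a] by (simp add: A_def)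
        finally show ?thesis .
      qed
      ultimately show ?thesis
        using u_le by (auto simp: A_def le_fun_def)
    qed
  qed
  then obtain m where m: "sublinear m" "m \<le> q" and "\<forall>a\<in>A. a \<le> m \<longrightarrow> a = m"
    by (auto simp: A_def)
  then have min: "p = m" if "sublinear p" "p \<le> m" for p
    using that order_trans[of p m q] by (auto simp: A_def)
  have neg: "m (- y) = - m y" for y
  proof -
    obtain p where "sublinear p" "p \<le> m" "p (- y) \<le> - m y"
      using sublinear_shrink[OF m(1), of "{y}" "m y"] by auto
    with min have "m (- y) \<le> - m y" by blast
    with sublinear_minus_le[OF m(1), of y] show ?thesis by simp
  qed
  have "linear m"
  proof
    show "m (x + y) = m x + m y" for x y
      using sublinear_add[OF m(1), of x y] sublinear_add[OF m(1), of "x + y" "- y"] neg[of y] by simp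
    show "m (r *\<^sub>R x) = r *\<^sub>R m x" for r x
      using sublinear_scaleR[OF m(1), of r x] sublinear_scaleR[OF m(1), of "- r" x] neg[of "r *\<^sub>R x"]
      by (cases "r \<ge> 0") auto
  qed
  from this m(2) show thesis by (rule that)
qed

text \<open>Domination by the shrunken functional already contains the separation:
  \<open>f (- d) \<le> p (- d) \<le> - \<beta>\<close>, and \<open>f\<close> is odd.\<close>

lemma mazur_orlicz:
  fixes q :: "'v::real_vector \<Rightarrow> real"
  assumes "sublinear q" "convex D" "D \<noteq> {}" "\<And>d. d \<in> D \<Longrightarrow> \<beta> \<le> q d"
  obtains f where "linear f" "f \<le> q" "\<And>d. d \<in> D \<Longrightarrow> \<beta> \<le> f d"
proof -
  obtain p where p: "sublinear p" "p \<le> q" "\<And>d. d \<in> D \<Longrightarrow> p (- d) \<le> - \<beta>"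
    by (rule sublinear_shrink[OF assms]) auto
  obtain f where f: "linear f" "f \<le> p"
    by (rule hahn_banach_sublinear[OF p(1)])
  show thesis
  proof
    show "f \<le> q" using f p by simp
    show "\<beta> \<le> f d" if "d \<in> D" for d
      using p(3)[OF that] le_funD[OF f(2), of "- d"] linear_neg[OF f(1), of d] by simp
  qed (rule f)
qed

section \<open>Pointwise vector spaces of functions and finite maxima of sublinear
  functionals\<close>

instantiation "fun" :: (type, real_vector) real_vector
begin

definition scaleR_fun :: "real \<Rightarrow> ('a \<Rightarrow> 'b) \<Rightarrow> 'a \<Rightarrow> 'b"
  where "scaleR_fun r f = (\<lambda>x. r *\<^sub>R f x)"

instance
  by standard (auto simp: scaleR_fun_def fun_eq_iff scaleR_add_left scaleR_add_right)

end

lemma sublinear_norm_linear: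
  assumes "linear h" "a \<ge> 0"
  shows "sublinear (\<lambda>v. a * norm (h v))"
proof -
  have "a * norm (h (x + y)) \<le> a * norm (h x) + a * norm (h y)" for x y
    using mult_left_mono[OF norm_triangle_ineq[of "h x" "h y"] assms(2)]
    by (simp add: linear_add[OF assms(1)] distrib_left)
  then show ?thesis
    by (simp add: sublinear_def linear_scale[OF assms(1)])
qed

lemma sublinear_max:
  assumes "sublinear f" "sublinear g"
  shows "sublinear (\<lambda>v. max (f v) (g v))"
proof -
  have "max (f (x + y)) (g (x + y)) \<le> max (f x) (g x) + max (f y) (g y)" for x y
    using sublinear_add[OF assms(1), of x y] sublinear_add[OF assms(2), of x y] by linarith
  moreover have "max (f (t *\<^sub>R x)) (g (t *\<^sub>R x)) = t * max (f x) (g x)" if "t \<ge> 0" for t x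
    using that by (simp add: sublinear_scaleR[OF assms(1)] sublinear_scaleR[OF assms(2)] max_mult_distrib_left)
  ultimately show ?thesis by (simp add: sublinear_def)
qed

text \<open>\<open>q\<close> is the maximum of 0 and the \<open>h j\<close>. Including 0 covers an
  empty \<open>J\<close>; the last clause records that \<open>q\<close> is the least nonnegative
  majorant.\<close>

lemma sublinear_Max:
  fixes h :: "'j \<Rightarrow> 'v::real_vector \<Rightarrow> real"
  assumes "finite J" "\<And>j. j \<in> J \<Longrightarrow> sublinear (h j)"
  shows "\<exists>q. sublinear q \<and> (\<forall>v. 0 \<le> q v) \<and> (\<forall>v. \<forall>j\<in>J. h j v \<le> q v) \<and>
    (\<forall>v r. 0 \<le> r \<longrightarrow> (\<forall>j\<in>J. h j v \<le> r) \<longrightarrow> q v \<le> r)"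
  using assms
proof (induction J rule: finite_induct)
  case empty
  show ?case by (rule exI[of _ "\<lambda>_. 0"]) (simp add: sublinear_def)
next
  case (insert j J)
  then obtain q where q: "sublinear q" "\<forall>v. 0 \<le> q v" "\<forall>v. \<forall>j\<in>J. h j v \<le> q v"
    "\<forall>v r. 0 \<le> r \<longrightarrow> (\<forall>j\<in>J. h j v \<le> r) \<longrightarrow> q v \<le> r"
    by auto
  show ?case
    using q insert.prems
    by (intro exI[of _ "\<lambda>v. max (h j v) (q v)"]) (auto intro: sublinear_max simp: le_max_iff_disj)
qed

section \<open>Bounded operators and functionals\<close>

lemma cblinfun_apply_scaleC: "cblinfun_apply F (c *\<^sub>C x) = c *\<^sub>C cblinfun_apply F x"
  by transfer simp

lemma bounded_linear_cblinfun_apply: "bounded_linear (cblinfun_apply F)"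
  by transfer (rule blinfun.bounded_linear_right)

lemma linear_cblinfun_apply: "linear (cblinfun_apply F)"
  by (rule bounded_linear.linear[OF bounded_linear_cblinfun_apply])

lemma cblinfun_apply_0: "cblinfun_apply 0 x = 0"
  by transfer simp

lemma cblinfun_apply_plus: "cblinfun_apply (F + G) x = cblinfun_apply F x + cblinfun_apply G x"
  by transfer (simp add: blinfun.add_left)

lemma cblinfun_apply_minus: "cblinfun_apply (F - G) x = cblinfun_apply F x - cblinfun_apply G x"
  by transfer (simp add: blinfun.diff_left)

lemma cblinfun_apply_scaleC_left: "cblinfun_apply (c *\<^sub>C F) x = c *\<^sub>C cblinfun_apply F x"
  by (simp add: cblinfun_apply.rep_eq blinfun_apply_scaleC_cblinfun)

lemma cblinfun_apply_sum: "cblinfun_apply (sum F A) x = (\<Sum>a\<in>A. cblinfun_apply (F a) x)"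
  by (induction A rule: infinite_finite_induct) (simp_all add: cblinfun_apply_0 cblinfun_apply_plus)

lemma norm_cblinfun_apply: "norm (cblinfun_apply F x) \<le> norm F * norm x"
  by transfer (rule norm_blinfun)

lemma norm_cblinfun_bound:
  "0 \<le> K \<Longrightarrow> (\<And>x. norm (cblinfun_apply F x) \<le> K * norm x) \<Longrightarrow> norm F \<le> K"
  by transfer (rule norm_blinfun_bound)

lemma cblinfun_of_linear:
  fixes f :: "'a::complex_normed_vector \<Rightarrow> 'b::complex_normed_vector"
  assumes add: "\<And>x y. f (x + y) = f x + f y" and scale: "\<And>c x. f (c *\<^sub>C x) = c *\<^sub>C f x"
    and bound: "\<And>x. norm (f x) \<le> K * norm x" and K: "0 \<le> K"
  obtains F where "cblinfun_apply F = f" "norm F \<le> K"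
proof -
  have "bounded_linear f"
    using bound by (intro bounded_linear_intro[where K = K])
      (simp_all add: add scale mult.commute flip: scaleC_of_real)
  then have F: "cblinfun_apply (CBlinfun (Blinfun f)) = f"
    by (simp add: cblinfun_apply.rep_eq CBlinfun_inverse bounded_linear_Blinfun_apply scale)
  show thesis
    by (rule that[OF F]) (rule norm_cblinfun_bound[OF K], unfold F, rule bound)
qed

text \<open>The imaginary part is forced to be \<open>- f (\<i> *\<^sub>C x)\<close>. Only
  boundedness of \<open>\<xi>\<close> is wanted, so adding the bounds of both parts is
  enough.\<close>

lemma real_functional_complexify:
  fixes f :: "'a::complex_normed_vector \<Rightarrow> real"
  assumes f: "linear f" and bound: "\<And>x. f x \<le> K * norm x" and K: "0 \<le> K"
  obtains \<xi> :: "'a dual" where "\<And>x. Re (cblinfun_apply \<xi> x) = f x"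
proof -
  have f_scaleC: "f (c *\<^sub>C x) = Re c * f x + Im c * f (\<i> *\<^sub>C x)" for c x
  proof -
    have "c *\<^sub>C x = Re c *\<^sub>R x + Im c *\<^sub>R (\<i> *\<^sub>C x)"
      by (simp add: scaleC_scaleC complex_eq[symmetric] mult.commute
          flip: scaleC_of_real scaleC_add_left)
    then show ?thesis
      by (simp add: linear_add[OF f] linear_scale[OF f])
  qed
  have abs_f: "\<bar>f x\<bar> \<le> K * norm x" for x
    using bound[of x] bound[of "- x"] by (simp add: linear_neg[OF f] abs_le_iff)
  define g where "g x = Complex (f x) (- f (\<i> *\<^sub>C x))" for x
  have "cmod (g x) \<le> (2 * K) * norm x" for x
    using cmod_le[of "g x"] abs_f[of x] abs_f[of "\<i> *\<^sub>C x"] by (simp add: g_def norm_scaleC)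
  moreover have "g (x + y) = g x + g y" for x y
    by (simp add: g_def linear_add[OF f] scaleC_add_right complex_eq_iff)
  moreover have "g (c *\<^sub>C x) = c *\<^sub>C g x" for c x
    by (simp add: g_def scaleC_complex_def complex_eq_iff f_scaleC[of c] scaleC_scaleC
        f_scaleC[of "\<i> * c"] algebra_simps)
  ultimately obtain \<xi> where "cblinfun_apply \<xi> = g"
    using K by (auto intro: cblinfun_of_linear[of g "2 * K"])
  then show thesis
    by (intro that[of \<xi>]) (simp add: g_def)
qed

text \<open>A vector on which \<open>\<xi>\<close> nearly reaches its norm is rescaled to norm
  \<open>\<rho>\<close> and rotated until the value is positive. The slack \<open>\<rho> > 1\<close>
  makes up for a norm that need not be attained.\<close>

lemma dual_norm_attained_approx:
  fixes \<xi> :: "'a::complex_normed_vector dual"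
  assumes "\<rho> > 1"
  obtains w where "norm w \<le> \<rho>" "norm \<xi> \<le> Re (cblinfun_apply \<xi> w)"
proof (cases "norm \<xi> = 0")
  case True
  then show thesis using assms
    by (intro that[of 0]) (simp_all add: linear_0[OF linear_cblinfun_apply])
next
  case False
  have "\<exists>x. norm \<xi> / \<rho> * norm x < cmod (cblinfun_apply \<xi> x)"
  proof (rule ccontr)
    assume "\<nexists>x. norm \<xi> / \<rho> * norm x < cmod (cblinfun_apply \<xi> x)"
    then have "norm \<xi> \<le> norm \<xi> / \<rho>"
      using assms by (intro norm_cblinfun_bound) (auto simp: not_less)
    then show False using assms False by (simp add: field_simps)
  qed
  then obtain x where x: "norm \<xi> / \<rho> * norm x < cmod (cblinfun_apply \<xi> x)" by blast
  define a where "a = cblinfun_apply \<xi> x"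
  have "0 \<le> norm \<xi> / \<rho> * norm x" using assms by simp
  with x have a: "a \<noteq> 0" by (auto simp: a_def)
  then have nx: "norm x > 0"
    by (auto simp: a_def linear_0[OF linear_cblinfun_apply])
  define w where "w = (of_real (\<rho> / norm x) * cnj (sgn a)) *\<^sub>C x"
  have "norm w \<le> \<rho>"
    using a nx assms by (simp add: w_def norm_scaleC norm_mult norm_sgn norm_divide)
  moreover have "cblinfun_apply \<xi> w = of_real (\<rho> / norm x * cmod a)"
  proof -
    have "cnj (sgn a) * a = of_real (cmod a)"
      using a by (simp add: sgn_eq complex_norm_square[symmetric] power2_eq_square mult.commute)
    then show ?thesis
      by (simp add: w_def cblinfun_apply_scaleC scaleC_complex_def mult.assoc flip: a_def)
  qed
  moreover have "norm \<xi> \<le> \<rho> / norm x * cmod a"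
    using x nx assms by (simp add: a_def field_simps)
  ultimately show thesis by (intro that[of w]) simp_all
qed

section \<open>Coordinates and pairings of square-summable sequences\<close>

lemma ell2_nth_add: "ell2_nth (x + y) i = ell2_nth x i + ell2_nth y i"
  by transfer simp

lemma ell2_nth_diff: "ell2_nth (x - y) i = ell2_nth x i - ell2_nth y i"
  by transfer simp

lemma ell2_nth_0: "ell2_nth 0 i = 0"
  by transfer simp

lemma ell2_nth_scaleC: "ell2_nth (c *\<^sub>C x) i = c * ell2_nth x i"
  by transfer simp

lemma ell2_nth_sum: "ell2_nth (sum f A) i = (\<Sum>a\<in>A. ell2_nth (f a) i)"
  by (induction A rule: infinite_finite_induct) (simp_all add: ell2_nth_0 ell2_nth_add)

lemma L2_set_ell2_le: "finite I \<Longrightarrow> L2_set (\<lambda>i. cmod (ell2_nth x i)) I \<le> norm x"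
  unfolding L2_set_def by transfer (auto intro!: sum_le_suminf)

lemma cmod_sum_mult_le_L2_set:
  "cmod (\<Sum>i\<in>I. a i * b i) \<le> L2_set (\<lambda>i. cmod (a i)) I * L2_set (\<lambda>i. cmod (b i)) I"
proof -
  have "cmod (\<Sum>i\<in>I. a i * b i) \<le> (\<Sum>i\<in>I. cmod (a i) * cmod (b i))"
    by (rule order_trans[OF norm_sum]) (simp add: norm_mult)
  also have "\<dots> \<le> L2_set (\<lambda>i. cmod (a i)) I * L2_set (\<lambda>i. cmod (b i)) I"
    using L2_set_mult_ineq[of "\<lambda>i. cmod (a i)" "\<lambda>i. cmod (b i)" I] by simp
  finally show ?thesis .
qed

lemma cblinfun_ell2_pairing_le:
  fixes S :: "'a::complex_normed_vector \<Rightarrow>\<^sub>C\<^sub>L ell2"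
  assumes "norm S \<le> 1" "L2_set (\<lambda>i. cmod (p i)) I \<le> 1" "finite I"
  shows "cmod (\<Sum>i\<in>I. p i * ell2_nth (cblinfun_apply S x) i) \<le> norm x"
proof -
  have "cmod (\<Sum>i\<in>I. p i * ell2_nth (cblinfun_apply S x) i) \<le> 1 * norm (cblinfun_apply S x)"
    by (rule order_trans[OF cmod_sum_mult_le_L2_set])
      (intro mult_mono assms L2_set_ell2_le; simp)
  also have "\<dots> \<le> norm S * norm x" using norm_cblinfun_apply by simp
  also have "\<dots> \<le> 1 * norm x" using assms by (intro mult_right_mono) auto
  finally show ?thesis by simp
qed

section \<open>Weak-star continuous approximation\<close>

lemma sum_fun_apply: "(\<Sum>a\<in>A. f a) x = (\<Sum>a\<in>A. f a x)"
  by (induction A rule: infinite_finite_induct) simp_all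

lemma linear_finite_support_eq_sum:
  fixes f :: "('i \<Rightarrow> 'a::real_vector) \<Rightarrow> real"
  assumes f: "linear f" and I: "finite I" and w: "\<And>i. i \<notin> I \<Longrightarrow> w i = 0"
  shows "f w = (\<Sum>i\<in>I. f (\<lambda>j. if j = i then w i else 0))"
proof -
  have "w = (\<Sum>i\<in>I. (\<lambda>j. if j = i then w i else 0))"
    using I w by (auto simp: fun_eq_iff sum_fun_apply)
  then have "f w = f (\<Sum>i\<in>I. (\<lambda>j. if j = i then w i else 0))"
    by (rule arg_cong)
  then show ?thesis
    by (simp only: linear_sum[OF f])
qed

text \<open>
  If no \<open>z\<close> exists, \<open>mazur_orlicz\<close> separates. Because \<open>P\<close> is finite, the separating functional
  consists of finitely many \<open>\<xi> p\<close> in the dual of \<open>'z\<close> and scalars \<open>l j\<close>. As it is bounded below on a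
  linear family in \<open>z\<close>, the combinations \<open>\<psi> i\<close> vanish, and applying \<open>S\<close> to \<open>\<psi> i = 0\<close> bounds the
  constant part by \<open>\<Sum>p\<in>P. norm (\<xi> p)\<close>, which the slack \<open>\<epsilon>\<close> forces to be less than 1.
\<close>

lemma helly_operator:
  fixes S :: "'z::complex_normed_vector dual \<Rightarrow>\<^sub>C\<^sub>L ell2"
  assumes S: "norm S \<le> 1" and P: "finite P" "\<And>p. p \<in> P \<Longrightarrow> L2_set (\<lambda>i. cmod (p i)) {..<m} \<le> 1"
    and \<Phi>: "finite \<Phi>" and \<epsilon>: "\<epsilon> > 0"
  shows "\<exists>z :: nat \<Rightarrow> 'z. (\<forall>p\<in>P. norm (\<Sum>i<m. p i *\<^sub>C z i) \<le> 1 + \<epsilon>) \<and>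
    (\<forall>\<phi>\<in>\<Phi>. \<forall>i<m. cmod (cblinfun_apply \<phi> (z i) - ell2_nth (cblinfun_apply S \<phi>) i) \<le> \<epsilon>)"
proof (rule ccontr)
  assume contra: "\<not> ?thesis"
  define J where "J = \<Phi> \<times> {..<m}"
  have J: "finite J" using \<Phi> by (simp add: J_def)
  define s where "s j = ell2_nth (cblinfun_apply S (fst j)) (snd j)" for j :: "'z dual \<times> nat"
  \<comment> \<open>Each requirement on \<open>z\<close> becomes one coordinate: a vector for every
    \<open>p\<close>, a scalar for every pair in \<open>J\<close>. Dividing by
    \<open>1 + \<epsilon>\<close> or \<open>\<epsilon>\<close> brings them all to the form
    \<open>h k v \<le> 1\<close>.\<close>
  define h :: "(nat \<Rightarrow> complex) + 'z dual \<times> nat \<Rightarrow>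
      ((nat \<Rightarrow> complex) \<Rightarrow> 'z) \<times> ('z dual \<times> nat \<Rightarrow> complex) \<Rightarrow> real"
    where "h k v = (case k of Inl p \<Rightarrow> inverse (1 + \<epsilon>) * norm (fst v p)
      | Inr j \<Rightarrow> inverse \<epsilon> * norm (snd v j))" for k v
  have fin: "finite (P <+> J)" using P J by simp
  have lin_fst: "linear (\<lambda>v. fst v p)" and lin_snd: "linear (\<lambda>v. snd v j)"
    for p j and v :: "((nat \<Rightarrow> complex) \<Rightarrow> 'z) \<times> ('z dual \<times> nat \<Rightarrow> complex)"
    by (auto intro!: linearI simp: scaleR_fun_def)
  have "h (Inl p) = (\<lambda>v. inverse (1 + \<epsilon>) * norm (fst v p))"
    "h (Inr j) = (\<lambda>v. inverse \<epsilon> * norm (snd v j))" for p j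
    by (simp_all add: h_def fun_eq_iff)
  then have "sublinear (h k)" for k
    using \<epsilon> by (cases k) (simp_all add: sublinear_norm_linear lin_fst lin_snd)
  then obtain q where q: "sublinear q" "\<And>v. 0 \<le> q v" "\<And>v k. k \<in> P <+> J \<Longrightarrow> h k v \<le> q v"
    and q_le: "\<And>v r. 0 \<le> r \<Longrightarrow> (\<And>k. k \<in> P <+> J \<Longrightarrow> h k v \<le> r) \<Longrightarrow> q v \<le> r"
    using sublinear_Max[OF fin, of h] by metis
  \<comment> \<open>The quantities to be bounded, as an affine function of \<open>z\<close>; hence
    the range is convex. The zeros outside \<open>P\<close> and \<open>J\<close> give the finite
    support on which \<open>split\<close> relies.\<close>
  define d where "d z = ((\<lambda>p. if p \<in> P then (\<Sum>i<m. p i *\<^sub>C z i) else 0),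
      (\<lambda>j. if j \<in> J then cblinfun_apply (fst j) (z (snd j)) - s j else 0))" for z :: "nat \<Rightarrow> 'z"
  have conv: "convex (range d)"
  proof (rule convexI)
    fix a b and u v :: real
    assume ab: "a \<in> range d" "b \<in> range d" and uv: "0 \<le> u" "0 \<le> v" "u + v = 1"
    obtain z z' where z: "a = d z" "b = d z'" using ab by auto
    have v: "v = 1 - u" using uv by simp
    have "u *\<^sub>R d z + v *\<^sub>R d z' = d (\<lambda>i. u *\<^sub>R z i + v *\<^sub>R z' i)"
      by (simp add: d_def prod_eq_iff fun_eq_iff scaleR_fun_def v scaleC_add_right sum.distrib sum_subtractf
          scaleR_sum_right linear_add[OF linear_cblinfun_apply] linear_scale[OF linear_cblinfun_apply]
          linear_diff[OF linear_cblinfun_apply] linear_scale[OF bounded_linear.linear[OF bounded_linear_scaleC]]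
          algebra_simps)
    then show "u *\<^sub>R a + v *\<^sub>R b \<in> range d" by (auto simp: z)
  qed
  \<comment> \<open>A \<open>z\<close> with \<open>q (d z) < 1\<close> would meet every requirement,
    against \<open>contra\<close>.\<close>
  have d_ge: "1 \<le> q (d z)" for z
  proof (rule ccontr)
    assume "\<not> 1 \<le> q (d z)"
    then have le: "h k (d z) \<le> 1" if "k \<in> P <+> J" for k
      using q(3)[OF that, of "d z"] by simp
    have "norm (\<Sum>i<m. p i *\<^sub>C z i) \<le> 1 + \<epsilon>" if "p \<in> P" for p
      using le[OF InlI[OF that]] that \<epsilon> by (simp add: h_def d_def field_simps)
    moreover have "cmod (cblinfun_apply \<phi> (z i) - ell2_nth (cblinfun_apply S \<phi>) i) \<le> \<epsilon>"
      if "\<phi> \<in> \<Phi>" "i < m" for \<phi> i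
      using le[OF InrI, of "(\<phi>, i)"] that \<epsilon> by (simp add: h_def d_def J_def s_def field_simps)
    ultimately show False using contra by blast
  qed
  have "1 \<le> q v" if "v \<in> range d" for v
    using that d_ge by auto
  then obtain f where f: "linear f" "f \<le> q" and "\<And>v. v \<in> range d \<Longrightarrow> 1 \<le> f v"
    by (rule mazur_orlicz[OF q(1) conv, of 1, rotated]) simp_all
  then have f_ge: "1 \<le> f (d z)" for z by simp
  define f1 where "f1 p x = f ((\<lambda>p'. if p' = p then x else 0), 0)" for p x
  define f2 where "f2 j t = f (0, (\<lambda>j'. if j' = j then t else 0))" for j t
  have split: "f (w, t) = (\<Sum>p\<in>P. f1 p (w p)) + (\<Sum>j\<in>J. f2 j (t j))"
    if "\<And>p. p \<notin> P \<Longrightarrow> w p = 0" "\<And>j. j \<notin> J \<Longrightarrow> t j = 0" for w t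
  proof -
    have "f (w, t) = f (w, 0) + f (0, t)"
      by (simp add: linear_add[OF f(1), symmetric])
    moreover have "linear (\<lambda>w. f (w, 0))" "linear (\<lambda>t. f (0, t))"
      by (rule linear_compose[OF _ f(1), unfolded o_def]; auto intro!: linearI)+
    ultimately show ?thesis
      using that P J by (simp add: linear_finite_support_eq_sum[of "\<lambda>w. f (w, 0)" P w]
          linear_finite_support_eq_sum[of "\<lambda>t. f (0, t)" J t] f1_def f2_def)
  qed
  have lin_f1: "linear (f1 p)" for p
    unfolding f1_def
    by (rule linear_compose[OF _ f(1), unfolded o_def])
      (auto intro!: linearI simp: fun_eq_iff scaleR_fun_def)
  have lin_f2: "linear (f2 j)" for j
    unfolding f2_def
    by (rule linear_compose[OF _ f(1), unfolded o_def])
      (auto intro!: linearI simp: fun_eq_iff scaleR_fun_def)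
  \<comment> \<open>With a single nonzero coordinate \<open>q\<close> is at most the term of that
    coordinate, so \<open>f1 p\<close> is bounded and can be complexified.\<close>
  have f1_le: "f1 p x \<le> inverse (1 + \<epsilon>) * norm x" for p x
    unfolding f1_def using \<epsilon>
    by (intro order_trans[OF le_funD[OF f(2)]] q_le) (auto simp: h_def)
  have "\<exists>\<xi> :: 'z dual. \<forall>x. Re (cblinfun_apply \<xi> x) = f1 p x" for p
    using real_functional_complexify[OF lin_f1 f1_le, of p] \<epsilon> by auto
  then obtain \<xi> :: "(nat \<Rightarrow> complex) \<Rightarrow> 'z dual"
    where \<xi>: "\<And>p x. Re (cblinfun_apply (\<xi> p) x) = f1 p x"
    by metis
  \<comment> \<open>A real-linear functional on the complex numbers is the real part of
    multiplication by this number.\<close>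
  define l where "l j = Complex (f2 j 1) (- f2 j \<i>)" for j
  have l: "f2 j t = Re (l j * t)" for j t
  proof -
    have "t = Re t *\<^sub>R 1 + Im t *\<^sub>R \<i>" by (simp add: complex_eq_iff)
    then have "f2 j t = f2 j (Re t *\<^sub>R 1 + Im t *\<^sub>R \<i>)" by simp
    then show ?thesis
      by (simp add: linear_add[OF lin_f2] linear_scale[OF lin_f2] l_def mult.commute del: scaleR_complex.simps)
  qed
  \<comment> \<open>\<open>\<psi> i\<close> gathers all that acts on \<open>z i\<close>, and
    \<open>b\<close> the constants from \<open>s\<close>; \<open>ge\<close> is
    \<open>1 \<le> f (d z)\<close> in these terms.\<close>
  define \<psi> where "\<psi> i = (\<Sum>p\<in>P. p i *\<^sub>C \<xi> p) + (\<Sum>\<phi>\<in>\<Phi>. l (\<phi>, i) *\<^sub>C \<phi>)" for i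
  define b where "b = Re (\<Sum>j\<in>J. l j * s j)"
  have ge: "1 \<le> Re (\<Sum>i<m. cblinfun_apply (\<psi> i) (z i)) - b" for z
  proof -
    have "1 \<le> f (d z)" by (rule f_ge)
    also have "\<dots> = (\<Sum>p\<in>P. Re (cblinfun_apply (\<xi> p) (\<Sum>i<m. p i *\<^sub>C z i))) +
        (\<Sum>j\<in>J. Re (l j * (cblinfun_apply (fst j) (z (snd j)) - s j)))"
      unfolding d_def by (subst split) (auto simp: \<xi> l)
    also have "\<dots> = Re ((\<Sum>p\<in>P. \<Sum>i<m. p i * cblinfun_apply (\<xi> p) (z i)) +
        (\<Sum>j\<in>J. l j * cblinfun_apply (fst j) (z (snd j)))) - b"
      by (simp add: linear_sum[OF linear_cblinfun_apply] cblinfun_apply_scaleC scaleC_complex_def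
          b_def right_diff_distrib sum_subtractf del: times_complex.sel)
    also have "(\<Sum>p\<in>P. \<Sum>i<m. p i * cblinfun_apply (\<xi> p) (z i)) +
        (\<Sum>j\<in>J. l j * cblinfun_apply (fst j) (z (snd j))) = (\<Sum>i<m. cblinfun_apply (\<psi> i) (z i))"
    proof -
      have "(\<Sum>j\<in>J. l j * cblinfun_apply (fst j) (z (snd j))) =
          (\<Sum>i<m. \<Sum>\<phi>\<in>\<Phi>. l (\<phi>, i) * cblinfun_apply \<phi> (z i))"
        unfolding J_def by (subst sum.swap) (simp add: sum.cartesian_product case_prod_beta)
      moreover have "(\<Sum>p\<in>P. \<Sum>i<m. p i * cblinfun_apply (\<xi> p) (z i)) =
          (\<Sum>i<m. \<Sum>p\<in>P. p i * cblinfun_apply (\<xi> p) (z i))"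
        by (rule sum.swap)
      ultimately show ?thesis
        by (simp add: \<psi>_def cblinfun_apply_plus cblinfun_apply_sum cblinfun_apply_scaleC_left
            scaleC_complex_def sum.distrib)
    qed
    finally show ?thesis .
  qed
  have \<psi>0: "\<psi> i = 0" if "i < m" for i
  proof (rule cblinfun_eqI, rule ccontr)
    fix y assume "cblinfun_apply (\<psi> i) y \<noteq> cblinfun_apply 0 y"
    then have y: "cblinfun_apply (\<psi> i) y \<noteq> 0" by (simp add: cblinfun_apply_0)
    \<comment> \<open>Chosen so that \<open>c *\<^sub>C y\<close> at index \<open>i\<close> and 0
      elsewhere makes the sum equal to \<open>b\<close>, whence \<open>ge\<close> reads
      \<open>1 \<le> 0\<close>.\<close>
    define c where "c = of_real b / cblinfun_apply (\<psi> i) y"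
    have "(\<Sum>i'<m. cblinfun_apply (\<psi> i') (if i' = i then c *\<^sub>C y else 0)) = of_real b"
      using that y by (simp add: if_distrib[of "cblinfun_apply _"] linear_0[OF linear_cblinfun_apply]
          cblinfun_apply_scaleC scaleC_complex_def c_def cong: if_cong)
    then show False
      using ge[of "\<lambda>i'. if i' = i then c *\<^sub>C y else 0"] by simp
  qed
  have "1 \<le> - b"
    using ge[of "\<lambda>_. 0"] by (simp add: linear_0[OF linear_cblinfun_apply])
  also have "- b = Re (\<Sum>p\<in>P. \<Sum>i<m. p i * ell2_nth (cblinfun_apply S (\<xi> p)) i)"
  proof -
    have "0 = (\<Sum>i<m. ell2_nth (cblinfun_apply S (\<psi> i)) i)"
      by (simp add: \<psi>0 linear_0[OF linear_cblinfun_apply] ell2_nth_0)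
    also have "\<dots> = (\<Sum>i<m. \<Sum>p\<in>P. p i * ell2_nth (cblinfun_apply S (\<xi> p)) i) +
        (\<Sum>i<m. \<Sum>\<phi>\<in>\<Phi>. l (\<phi>, i) * s (\<phi>, i))"
      by (simp add: \<psi>_def linear_add[OF linear_cblinfun_apply] linear_sum[OF linear_cblinfun_apply]
          cblinfun_apply_scaleC ell2_nth_add ell2_nth_sum ell2_nth_scaleC s_def sum.distrib)
    also have "(\<Sum>i<m. \<Sum>\<phi>\<in>\<Phi>. l (\<phi>, i) * s (\<phi>, i)) = (\<Sum>j\<in>J. l j * s j)"
      unfolding J_def by (subst sum.swap) (simp add: sum.cartesian_product case_prod_beta)
    also have "(\<Sum>i<m. \<Sum>p\<in>P. p i * ell2_nth (cblinfun_apply S (\<xi> p)) i) =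
        (\<Sum>p\<in>P. \<Sum>i<m. p i * ell2_nth (cblinfun_apply S (\<xi> p)) i)"
      by (rule sum.swap)
    finally have "- (\<Sum>j\<in>J. l j * s j) = (\<Sum>p\<in>P. \<Sum>i<m. p i * ell2_nth (cblinfun_apply S (\<xi> p)) i)"
      by (simp add: neg_eq_iff_add_eq_0 add.commute)
    then show ?thesis
      unfolding b_def by (metis uminus_complex.sel(1))
  qed
  also have "\<dots> \<le> cmod (\<Sum>p\<in>P. \<Sum>i<m. p i * ell2_nth (cblinfun_apply S (\<xi> p)) i)"
    by (rule complex_Re_le_cmod)
  also have "\<dots> \<le> (\<Sum>p\<in>P. norm (\<xi> p))"
    using S P by (intro order_trans[OF norm_sum] sum_mono cblinfun_ell2_pairing_le) auto
  finally have 1: "1 \<le> (\<Sum>p\<in>P. norm (\<xi> p))" .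
  \<comment> \<open>The near-norming vectors spend half of the slack. Side by side they form one
    argument of \<open>f\<close>, where \<open>q\<close> takes a maximum over \<open>p\<close> and
    not a sum, so the value is at most
    \<open>(1 + \<epsilon> / 2) / (1 + \<epsilon>)\<close>.\<close>
  have "\<exists>x. norm x \<le> 1 + \<epsilon> / 2 \<and> norm (\<xi> p) \<le> Re (cblinfun_apply (\<xi> p) x)" for p
    using dual_norm_attained_approx[of "1 + \<epsilon> / 2" "\<xi> p"] \<epsilon> by auto
  then obtain w where w: "\<And>p. norm (w p) \<le> 1 + \<epsilon> / 2"
    "\<And>p. norm (\<xi> p) \<le> Re (cblinfun_apply (\<xi> p) (w p))"
    by metis
  have "(\<Sum>p\<in>P. norm (\<xi> p)) \<le> (\<Sum>p\<in>P. f1 p (w p))"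
    using w(2) by (intro sum_mono) (simp add: \<xi>)
  also have "\<dots> = f ((\<lambda>p. if p \<in> P then w p else 0), 0)"
    by (subst split) (auto simp: linear_0[OF lin_f2])
  also have "\<dots> \<le> inverse (1 + \<epsilon>) * (1 + \<epsilon> / 2)"
    using \<epsilon> w(1) by (intro order_trans[OF le_funD[OF f(2)]] q_le)
      (auto simp: h_def intro!: mult_left_mono)
  also have "\<dots> < 1" using \<epsilon> by (simp add: field_simps)
  finally show False using 1 by simp
qed

text \<open>A coordinatewise grid of net points need not lie in the ball. Each grid point near the
  ball is replaced by a nearby ball element, and the two halves of \<open>\<delta>\<close> pay for
  the detour.\<close>

lemma finite_net_L2_ball:
  fixes \<delta> :: real
  assumes "\<delta> > 0"
  obtains P :: "(nat \<Rightarrow> complex) set" where "finite P"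
    "\<And>p. p \<in> P \<Longrightarrow> L2_set (\<lambda>i. cmod (p i)) {..<m} \<le> 1"
    "\<And>a. L2_set (\<lambda>i. cmod (a i)) {..<m} \<le> 1 \<Longrightarrow> \<exists>p\<in>P. \<forall>i<m. cmod (a i - p i) \<le> \<delta>"
proof -
  obtain N :: "complex set" where N: "finite N" "cball 0 1 \<subseteq> (\<Union>x\<in>N. ball x (\<delta> / 2))"
    using seq_compact_imp_totally_bounded[of "cball (0 :: complex) 1"] assms compact_cball
    by (metis compact_eq_seq_compact_metric half_gt_zero)
  define near where "near g a \<longleftrightarrow>
      L2_set (\<lambda>i. cmod (a i)) {..<m} \<le> 1 \<and> (\<forall>i<m. dist (g i) (a i) < \<delta> / 2)" for g a
  define G where "G = {g \<in> PiE {..<m} (\<lambda>_. N). \<exists>a. near g a}"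
  define P where "P = (\<lambda>g. SOME a. near g a) ` G"
  have near: "near g (SOME a. near g a)" if "g \<in> G" for g
  proof -
    from that obtain a where "near g a" by (auto simp: G_def)
    then show ?thesis by (rule someI[of "near g" a])
  qed
  show thesis
  proof
    show "finite P"
      using N by (simp add: P_def G_def finite_PiE)
    show "L2_set (\<lambda>i. cmod (p i)) {..<m} \<le> 1" if "p \<in> P" for p
      using that near by (auto simp: P_def near_def)
    fix a :: "nat \<Rightarrow> complex" assume a: "L2_set (\<lambda>i. cmod (a i)) {..<m} \<le> 1"
    have "\<exists>x\<in>N. dist x (a i) < \<delta> / 2" if "i < m" for i
    proof -
      have "a i \<in> cball 0 1"
        using member_le_L2_set[of "{..<m}" i "\<lambda>i. cmod (a i)"] a that by simp
      then have "a i \<in> (\<Union>x\<in>N. ball x (\<delta> / 2))" using N(2) by blast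
      then show ?thesis by auto
    qed
    then obtain g where g: "\<And>i. i < m \<Longrightarrow> g i \<in> N \<and> dist (g i) (a i) < \<delta> / 2" by metis
    define g' where "g' = restrict g {..<m}"
    have "near g' a" using g a by (simp add: near_def g'_def)
    moreover have "g' \<in> PiE {..<m} (\<lambda>_. N)" using g by (auto simp: g'_def)
    ultimately have G: "g' \<in> G" by (auto simp: G_def)
    define p where "p = (SOME a. near g' a)"
    have "cmod (a i - p i) \<le> \<delta>" if "i < m" for i
    proof -
      have "dist (g' i) (a i) < \<delta> / 2" "dist (g' i) (p i) < \<delta> / 2"
        using near[OF G] \<open>near g' a\<close> that by (auto simp: near_def p_def)
      then show ?thesis
        using dist_triangle_half_r[of "g' i" "a i" \<delta> "p i"] by (simp add: dist_norm)
    qed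
    then show "\<exists>p\<in>P. \<forall>i<m. cmod (a i - p i) \<le> \<delta>"
      using G by (auto simp: P_def p_def)
  qed
qed

text \<open>
  The test vectors \<open>P\<close> are a net together with the unit vectors: the latter give the a priori
  bound on each \<open>y i\<close> that lets the net control the whole unit ball.
\<close>

lemma goldstine_operator:
  fixes S :: "'z::complex_normed_vector dual \<Rightarrow>\<^sub>C\<^sub>L ell2"
  assumes S: "norm S \<le> 1" and \<Phi>: "finite \<Phi>" and \<epsilon>: "\<epsilon> > 0"
  obtains z :: "nat \<Rightarrow> 'z"
  where "\<And>\<phi>. L2_set (\<lambda>i. cmod (cblinfun_apply \<phi> (z i))) {..<m} \<le> norm \<phi>"
    "\<And>\<phi> i. \<phi> \<in> \<Phi> \<Longrightarrow> i < m \<Longrightarrow>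
      cmod (cblinfun_apply \<phi> (z i) - ell2_nth (cblinfun_apply S \<phi>) i) \<le> \<epsilon>"
proof -
  define K where "K = (\<Sum>\<phi>\<in>\<Phi>. norm \<phi>)"
  have K: "0 \<le> K" by (simp add: K_def sum_nonneg)
  \<comment> \<open>The final error will be \<open>\<eta> + 3 * \<eta> * K\<close>, with
    \<open>K\<close> above every norm in \<open>\<Phi>\<close>. The cap 1 yields
    \<open>\<kappa> \<le> 1 + 3 * \<eta>\<close>.\<close>
  define \<eta> where "\<eta> = min 1 (\<epsilon> / (1 + 3 * K))"
  have "\<eta> \<le> \<epsilon> / (1 + 3 * K)" by (simp add: \<eta>_def)
  then have "\<eta> * (1 + 3 * K) \<le> \<epsilon>"
    using K by (simp add: pos_le_divide_eq)
  moreover have "0 < \<eta>" "\<eta> \<le> 1"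
    using \<epsilon> K by (simp_all add: \<eta>_def)
  ultimately have \<eta>: "0 < \<eta>" "\<eta> \<le> 1" "\<eta> * (1 + 3 * K) \<le> \<epsilon>"
    by simp_all
  \<comment> \<open>Passing to a net point costs \<open>\<delta>\<close> in each of \<open>m\<close>
    coordinates, at most \<open>\<eta>\<close> in total; the added 1 covers
    \<open>m = 0\<close>.\<close>
  define \<delta> where "\<delta> = \<eta> / (real m + 1)"
  have \<delta>: "\<delta> > 0" "real m * \<delta> \<le> \<eta>" using \<eta> by (simp_all add: \<delta>_def field_simps)
  define \<kappa> where "\<kappa> = (1 + \<eta>) * (1 + \<eta>)"
  have \<kappa>: "\<kappa> \<ge> 1" "\<kappa> \<le> 1 + 3 * \<eta>"
    using \<eta> mult_left_mono[of \<eta> 1 \<eta>] by (auto simp: \<kappa>_def algebra_simps)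
  obtain N :: "(nat \<Rightarrow> complex) set" where N: "finite N"
    "\<And>p. p \<in> N \<Longrightarrow> L2_set (\<lambda>i. cmod (p i)) {..<m} \<le> 1"
    "\<And>a. L2_set (\<lambda>i. cmod (a i)) {..<m} \<le> 1 \<Longrightarrow> \<exists>p\<in>N. \<forall>i<m. cmod (a i - p i) \<le> \<delta>"
    using finite_net_L2_ball[OF \<delta>(1)] by blast
  define e :: "nat \<Rightarrow> nat \<Rightarrow> complex" where "e i j = (if j = i then 1 else 0)" for i j
  define P where "P = N \<union> e ` {..<m}"
  have e: "L2_set (\<lambda>j. cmod (e i j)) {..<m} \<le> 1" for i
  proof -
    have "cmod (e i j) = (if j = i then 1 else 0)" for j by (simp add: e_def)
    then show ?thesis by (intro order_trans[OF L2_set_le_sum]) simp_all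
  qed
  have "finite P" "\<And>p. p \<in> P \<Longrightarrow> L2_set (\<lambda>i. cmod (p i)) {..<m} \<le> 1"
    using N e by (auto simp: P_def)
  from helly_operator[OF S this \<Phi> \<eta>(1)]
  obtain y :: "nat \<Rightarrow> 'z" where y: "\<And>p. p \<in> P \<Longrightarrow> norm (\<Sum>i<m. p i *\<^sub>C y i) \<le> 1 + \<eta>"
    "\<And>\<phi> i. \<phi> \<in> \<Phi> \<Longrightarrow> i < m \<Longrightarrow>
      cmod (cblinfun_apply \<phi> (y i) - ell2_nth (cblinfun_apply S \<phi>) i) \<le> \<eta>"
    by blast
  have norm_y: "norm (y i) \<le> 1 + \<eta>" if "i < m" for i
  proof -
    have "(\<Sum>j<m. e i j *\<^sub>C y j) = (\<Sum>j<m. if j = i then y j else 0)"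
      by (rule sum.cong) (auto simp: e_def complex_vector.scale_one complex_vector.scale_zero_left)
    also have "\<dots> = y i" using that by simp
    finally show ?thesis using y(1)[of "e i"] that by (simp add: P_def)
  qed
  have comb: "norm (\<Sum>i<m. a i *\<^sub>C y i) \<le> \<kappa>"
    if a: "L2_set (\<lambda>i. cmod (a i)) {..<m} \<le> 1" for a
  proof -
    obtain p where p: "p \<in> N" "\<And>i. i < m \<Longrightarrow> cmod (a i - p i) \<le> \<delta>" using N(3)[OF a] by blast
    have "(\<Sum>i<m. a i *\<^sub>C y i) = (\<Sum>i<m. p i *\<^sub>C y i) + (\<Sum>i<m. (a i - p i) *\<^sub>C y i)"
      by (simp add: sum.distrib[symmetric] scaleC_add_left[symmetric])
    moreover have "norm (\<Sum>i<m. p i *\<^sub>C y i) \<le> 1 + \<eta>" using p by (intro y(1)) (simp add: P_def)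
    moreover have "norm (\<Sum>i<m. (a i - p i) *\<^sub>C y i) \<le> (\<Sum>i<m. \<delta> * (1 + \<eta>))"
      using p \<delta> norm_y by (intro sum_norm_le) (auto simp: norm_scaleC intro!: mult_mono)
    moreover have "(\<Sum>i<m. \<delta> * (1 + \<eta>)) \<le> \<eta> * (1 + \<eta>)"
      using mult_right_mono[OF \<delta>(2), of "1 + \<eta>"] \<eta> by (simp add: mult.assoc)
    ultimately show ?thesis
      using norm_triangle_ineq[of "\<Sum>i<m. p i *\<^sub>C y i" "\<Sum>i<m. (a i - p i) *\<^sub>C y i"]
      by (simp add: \<kappa>_def algebra_simps)
  qed
  have L2: "L2_set (\<lambda>i. cmod (cblinfun_apply \<phi> (y i))) {..<m} \<le> \<kappa> * norm \<phi>" for \<phi>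
  proof (cases "L2_set (\<lambda>i. cmod (cblinfun_apply \<phi> (y i))) {..<m} = 0")
    case True
    then show ?thesis using \<kappa> by simp
  next
    case False
    define s where "s = L2_set (\<lambda>i. cmod (cblinfun_apply \<phi> (y i))) {..<m}"
    have s: "s > 0" using False by (simp add: s_def order_less_le)
    have s2: "(\<Sum>i<m. (cmod (cblinfun_apply \<phi> (y i)))\<^sup>2) = s\<^sup>2"
      by (simp add: s_def L2_set_def sum_nonneg)
    \<comment> \<open>The equality case of Cauchy-Schwarz: on the combination with these unit
      coefficients \<open>\<phi>\<close> takes the value \<open>s\<close>.\<close>
    define a where "a i = cnj (cblinfun_apply \<phi> (y i)) / of_real s" for i
    have "L2_set (\<lambda>i. cmod (a i)) {..<m} = s * inverse s"
      using s by (subst s_def) (subst L2_set_left_distrib, simp, simp add: a_def norm_mult norm_inverse divide_inverse)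
    then have a1: "L2_set (\<lambda>i. cmod (a i)) {..<m} \<le> 1" using s by simp
    have "cblinfun_apply \<phi> (\<Sum>i<m. a i *\<^sub>C y i) = (\<Sum>i<m. of_real ((cmod (cblinfun_apply \<phi> (y i)))\<^sup>2) / of_real s)"
      by (simp add: linear_sum[OF linear_cblinfun_apply] cblinfun_apply_scaleC scaleC_complex_def
          a_def complex_norm_square[symmetric] mult.commute)
    also have "\<dots> = of_real (s\<^sup>2) / of_real s"
      by (simp only: s2[symmetric] of_real_sum sum_divide_distrib)
    also have "\<dots> = of_real s" using s by (simp add: power2_eq_square)
    finally have "s = cmod (cblinfun_apply \<phi> (\<Sum>i<m. a i *\<^sub>C y i))" using s by simp
    also have "\<dots> \<le> norm \<phi> * norm (\<Sum>i<m. a i *\<^sub>C y i)" by (rule norm_cblinfun_apply)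
    also have "\<dots> \<le> norm \<phi> * \<kappa>" by (intro mult_left_mono comb a1) simp
    finally show ?thesis by (simp add: s_def mult.commute)
  qed
  \<comment> \<open>Scaling by \<open>inverse \<kappa>\<close> restores the exact bound
    \<open>norm \<phi>\<close>; for functionals in \<open>\<Phi>\<close> this costs at most
    \<open>3 * \<eta> * K\<close> per coordinate.\<close>
  define z where "z i = inverse \<kappa> *\<^sub>R y i" for i
  have z: "cblinfun_apply \<phi> (z i) = inverse \<kappa> *\<^sub>R cblinfun_apply \<phi> (y i)" for \<phi> i
    by (simp add: z_def linear_scale[OF linear_cblinfun_apply])
  show thesis
  proof
    fix \<phi>
    have "L2_set (\<lambda>i. cmod (cblinfun_apply \<phi> (z i))) {..<m} =
        inverse \<kappa> * L2_set (\<lambda>i. cmod (cblinfun_apply \<phi> (y i))) {..<m}"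
      using \<kappa> by (subst L2_set_right_distrib) (auto simp: z)
    also have "\<dots> \<le> inverse \<kappa> * (\<kappa> * norm \<phi>)" using \<kappa> L2 by (intro mult_left_mono) auto
    also have "\<dots> = norm \<phi>" using \<kappa> by simp
    finally show "L2_set (\<lambda>i. cmod (cblinfun_apply \<phi> (z i))) {..<m} \<le> norm \<phi>" .
  next
    fix \<phi> i assume i: "\<phi> \<in> \<Phi>" "i < m"
    define t where "t = ell2_nth (cblinfun_apply S \<phi>) i"
    have "norm \<phi> \<le> K" unfolding K_def using i \<Phi> by (intro member_le_sum) auto
    moreover have "cmod t \<le> norm \<phi>"
      using cblinfun_ell2_pairing_le[OF S, of "\<lambda>_. 1" "{i}" \<phi>] by (simp add: t_def)
    ultimately have t: "cmod t \<le> K" by simp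
    have \<kappa>': "1 - inverse \<kappa> \<le> 3 * \<eta>" "0 \<le> 1 - inverse \<kappa>" "inverse \<kappa> \<le> 1" "0 \<le> inverse \<kappa>"
    proof -
      have "(\<kappa> - 1) / \<kappa> \<le> (\<kappa> - 1) / 1" using \<kappa> by (intro divide_left_mono) auto
      then show "1 - inverse \<kappa> \<le> 3 * \<eta>" using \<kappa> by (simp add: diff_divide_distrib inverse_eq_divide)
    qed (use \<kappa> in \<open>auto simp: field_simps\<close>)
    have "cblinfun_apply \<phi> (z i) - t =
        inverse \<kappa> *\<^sub>R (cblinfun_apply \<phi> (y i) - t) - (1 - inverse \<kappa>) *\<^sub>R t"
      by (simp add: z algebra_simps)
    also have "cmod \<dots> \<le> inverse \<kappa> * cmod (cblinfun_apply \<phi> (y i) - t) + (1 - inverse \<kappa>) * cmod t"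
      using \<kappa>' by (intro order_trans[OF norm_triangle_ineq4]) simp
    also have "\<dots> \<le> 1 * \<eta> + (3 * \<eta>) * K"
      using \<kappa>' y(2)[OF i] t \<eta> K by (intro add_mono mult_mono) (auto simp: t_def)
    also have "\<dots> \<le> \<epsilon>" using \<eta> by (simp add: algebra_simps)
    finally show "cmod (cblinfun_apply \<phi> (z i) - ell2_nth (cblinfun_apply S \<phi>) i) \<le> \<epsilon>"
      by (simp add: t_def)
  qed
qed

lemma ell2_of_bounded_L2:
  assumes "\<And>n. L2_set (\<lambda>i. cmod (x i)) {..<n} \<le> B"
  obtains u where "ell2_nth u = x" "norm u \<le> B"
proof -
  have B: "0 \<le> B" using assms[of 0] by simp
  have le: "(\<Sum>i<n. (cmod (x i))\<^sup>2) \<le> B\<^sup>2" for n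
    using assms[of n] B by (simp add: L2_set_def sqrt_le_D real_le_lsqrt)
  have sm: "summable (\<lambda>i. (cmod (x i))\<^sup>2)"
    by (rule summableI_nonneg_bounded[OF _ le]) simp
  then have nth: "ell2_nth (Ell2 x) = x" by (simp add: Ell2_inverse)
  have "(\<Sum>i. (cmod (x i))\<^sup>2) \<le> B\<^sup>2" by (rule suminf_le_const[OF sm le])
  then have "norm (Ell2 x) \<le> B"
    using B by (simp add: norm_ell2.rep_eq nth real_le_lsqrt)
  with nth show thesis by (rule that)
qed

text \<open>Packs the points into a contraction that may compete in the supremum of
  \<open>chang_number\<close>. Coordinates from \<open>m\<close> on are set to 0, so the operator
  consists of finitely many evaluations.\<close>

lemma evaluation_operator:
  fixes z :: "nat \<Rightarrow> 'z::complex_normed_vector"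
  assumes "\<And>\<phi>. L2_set (\<lambda>i. cmod (cblinfun_apply \<phi> (z i))) {..<m} \<le> norm \<phi>"
  obtains R :: "'z dual \<Rightarrow>\<^sub>C\<^sub>L ell2" where "norm R \<le> 1"
    "\<And>\<phi> i. i < m \<Longrightarrow> ell2_nth (cblinfun_apply R \<phi>) i = cblinfun_apply \<phi> (z i)"
proof -
  define x where "x \<phi> i = (if i < m then cblinfun_apply \<phi> (z i) else 0)" for \<phi> :: "'z dual" and i
  have "L2_set (\<lambda>i. cmod (x \<phi> i)) {..<n} \<le> norm \<phi>" for \<phi> n
  proof -
    have "L2_set (\<lambda>i. cmod (x \<phi> i)) {..<n} \<le> L2_set (\<lambda>i. cmod (cblinfun_apply \<phi> (z i))) {..<m}"
    proof -
      have "(\<Sum>i<n. (cmod (x \<phi> i))\<^sup>2) = (\<Sum>i\<in>{..<n} \<inter> {..<m}. (cmod (cblinfun_apply \<phi> (z i)))\<^sup>2)"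
        by (subst sum.inter_restrict) (auto simp: x_def intro!: sum.cong)
      also have "\<dots> \<le> (\<Sum>i<m. (cmod (cblinfun_apply \<phi> (z i)))\<^sup>2)"
        by (rule sum_mono2) auto
      finally show ?thesis by (simp add: L2_set_def)
    qed
    with assms[of \<phi>] show ?thesis by simp
  qed
  then have "\<exists>u. ell2_nth u = x \<phi> \<and> norm u \<le> norm \<phi>" for \<phi>
    using ell2_of_bounded_L2[of "x \<phi>" "norm \<phi>"] by blast
  then obtain r where r: "\<And>\<phi>. ell2_nth (r \<phi>) = x \<phi>" "\<And>\<phi>. norm (r \<phi>) \<le> norm \<phi>" by metis
  obtain R where R: "cblinfun_apply R = r" "norm R \<le> 1"
  proof (rule cblinfun_of_linear[of r 1])
    show "r (\<phi> + \<psi>) = r \<phi> + r \<psi>" for \<phi> \<psi>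
      by (rule ell2_eqI) (simp add: r ell2_nth_add x_def cblinfun_apply_plus)
    show "r (c *\<^sub>C \<phi>) = c *\<^sub>C r \<phi>" for c \<phi>
      by (rule ell2_eqI) (simp add: r ell2_nth_scaleC x_def cblinfun_apply_scaleC_left scaleC_complex_def)
  qed (simp_all add: r)
  show thesis
    using R by (intro that[of R]) (simp_all add: r x_def)
qed

section \<open>Compactness of finite-rank approximation\<close>

text \<open>
  In this form the rank bound passes to pointwise limits, since the coefficients can be normalised.
\<close>

lemma finite_rank_less_iff:
  fixes F :: "'a::complex_normed_vector \<Rightarrow>\<^sub>C\<^sub>L 'b::complex_normed_vector"
  shows "F \<in> finite_rank_less k \<longleftrightarrow>
    (\<forall>x. \<exists>\<alpha>. (\<exists>j<k. \<alpha> j \<noteq> 0) \<and> (\<Sum>j<k. \<alpha> j *\<^sub>C cblinfun_apply F (x j)) = 0)"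
    (is "_ \<longleftrightarrow> (\<forall>x. ?dep x)")
proof
  assume "F \<in> finite_rank_less k"
  then obtain W where W: "finite W" "range (cblinfun_apply F) \<subseteq> cspan W"
    and dim: "cdim (range (cblinfun_apply F)) < k"
    by (auto simp: finite_rank_less_def finite_cdim_def)
  obtain B where B: "B \<subseteq> range (cblinfun_apply F)" "\<not> cdependent B"
    "range (cblinfun_apply F) \<subseteq> cspan B" "card B = cdim (range (cblinfun_apply F))"
    by (rule complex_vector.basis_exists)
  have finB: "finite B"
    using complex_vector.independent_span_bound[OF W(1) B(2)] B(1) W(2) by auto
  show "\<forall>x. ?dep x"
  proof
    fix x :: "nat \<Rightarrow> 'a"
    define y where "y j = cblinfun_apply F (x j)" for j
    \<comment> \<open>Dependence of a set cannot see a vector listed twice, so repeated values get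
      their own relation with coefficients 1 and -1.\<close>
    show "?dep x"
    proof (cases "inj_on y {..<k}")
      case True
      have "y ` {..<k} \<subseteq> cspan B" using B(3) unfolding y_def by blast
      moreover have "card (y ` {..<k}) = k" using card_image[OF True] by simp
      ultimately have "cdependent (y ` {..<k})"
        using complex_vector.independent_span_bound[OF finB, of "y ` {..<k}"] B(4) dim by auto
      then obtain u where u: "\<exists>v\<in>y ` {..<k}. u v \<noteq> 0" "(\<Sum>v\<in>y ` {..<k}. u v *\<^sub>C v) = 0"
        using complex_vector.dependent_finite[of "y ` {..<k}"] by auto
      then have "(\<Sum>j<k. u (y j) *\<^sub>C y j) = 0"
        by (simp add: sum.reindex[OF True])
      with u(1) show ?thesis
        by (intro exI[of _ "\<lambda>j. u (y j)"]) (auto simp: y_def)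
    next
      case False
      then obtain a b where ab: "a < k" "b < k" "a \<noteq> b" "y a = y b"
        by (auto simp: inj_on_def)
      define \<alpha> :: "nat \<Rightarrow> complex" where "\<alpha> j = (if j = a then 1 else 0) - (if j = b then 1 else 0)" for j
      have "\<alpha> j *\<^sub>C y j = (if j = a then y a else 0) - (if j = b then y b else 0)" for j
        by (simp add: \<alpha>_def complex_vector.scale_left_diff_distrib complex_vector.scale_one
            complex_vector.scale_zero_left complex_vector.scale_minus_left)
      then have "(\<Sum>j<k. \<alpha> j *\<^sub>C y j) = 0"
        using ab by (simp add: sum_subtractf)
      moreover have "\<alpha> a \<noteq> 0" using ab by (simp add: \<alpha>_def)
      ultimately show ?thesis using ab by (auto simp: y_def)
    qed
  qed
next
  assume dep: "\<forall>x. ?dep x"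
  obtain B where B: "B \<subseteq> range (cblinfun_apply F)" "\<not> cdependent B"
    "range (cblinfun_apply F) \<subseteq> cspan B" "card B = cdim (range (cblinfun_apply F))"
    by (rule complex_vector.basis_exists)
  \<comment> \<open>A basis with at least \<open>k\<close> members, possibly infinitely many, would
    contain \<open>k\<close> independent vectors of the range, whose preimages contradict
    \<open>dep\<close>.\<close>
  have "finite B \<and> card B < k"
  proof (rule ccontr)
    assume "\<not> (finite B \<and> card B < k)"
    then obtain Y where Y: "Y \<subseteq> B" "finite Y" "card Y = k"
      by (metis infinite_arbitrarily_large not_less obtain_subset_with_card_n)
    then obtain h where h: "bij_betw h {..<k} Y"
      using ex_bij_betw_nat_finite[of Y] by (auto simp: atLeast0LessThan)
    have "\<exists>x. cblinfun_apply F x = h j" if "j < k" for j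
      using bij_betwE[OF h] that Y B(1) by (metis imageE lessThan_iff subset_iff)
    then obtain x where x: "\<And>j. j < k \<Longrightarrow> cblinfun_apply F (x j) = h j" by metis
    obtain \<alpha> j where \<alpha>: "j < k" "\<alpha> j \<noteq> 0" "(\<Sum>j<k. \<alpha> j *\<^sub>C cblinfun_apply F (x j)) = 0"
      using dep by blast
    define u where "u v = \<alpha> (inv_into {..<k} h v)" for v
    have u: "u (h j) = \<alpha> j" if "j < k" for j
      using that bij_betw_inv_into_left[OF h] by (simp add: u_def)
    have "(\<Sum>v\<in>Y. u v *\<^sub>C v) = (\<Sum>j<k. u (h j) *\<^sub>C h j)"
      by (rule sum.reindex_bij_betw[OF h, symmetric])
    also have "\<dots> = 0" using \<alpha>(3) by (simp add: u x cong: sum.cong_simp)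
    finally have "u (h j) = 0"
      using complex_vector.independentD[OF B(2) Y(2,1)] bij_betwE[OF h] \<alpha>(1) by auto
    then show False using \<alpha> by (simp add: u)
  qed
  with B show "F \<in> finite_rank_less k"
    by (auto simp: finite_rank_less_def finite_cdim_def)
qed

lemma finite_rank_less_compose:
  assumes "F \<in> finite_rank_less k"
  shows "F o\<^sub>C P \<in> finite_rank_less k"
  unfolding finite_rank_less_iff cblinfun_apply_compose
proof
  fix x
  show "\<exists>\<alpha>. (\<exists>j<k. \<alpha> j \<noteq> 0) \<and> (\<Sum>j<k. \<alpha> j *\<^sub>C cblinfun_apply F (cblinfun_apply P (x j))) = 0"
    using assms[unfolded finite_rank_less_iff, rule_format, of "\<lambda>j. cblinfun_apply P (x j)"] .
qed

text \<open>Total modulus 1 both bounds the coefficients, for compactness, and keeps their limit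
  from vanishing.\<close>

lemma finite_rank_less_normalized:
  assumes "F \<in> finite_rank_less k"
  obtains \<alpha> where "(\<Sum>j<k. cmod (\<alpha> j)) = 1" "(\<Sum>j<k. \<alpha> j *\<^sub>C cblinfun_apply F (x j)) = 0"
proof -
  obtain \<beta> i where \<beta>: "i < k" "\<beta> i \<noteq> 0" "(\<Sum>j<k. \<beta> j *\<^sub>C cblinfun_apply F (x j)) = 0"
    using assms unfolding finite_rank_less_iff by blast
  define r where "r = (\<Sum>j<k. cmod (\<beta> j))"
  have "cmod (\<beta> i) \<le> r" unfolding r_def using \<beta>(1) by (intro member_le_sum) auto
  then have r: "r > 0" using \<beta>(2) by (smt (verit) zero_less_norm_iff)
  show thesis
  proof
    show "(\<Sum>j<k. cmod (\<beta> j / of_real r)) = 1"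
      using r by (simp add: norm_divide flip: sum_divide_distrib r_def)
    have "(\<Sum>j<k. (\<beta> j / of_real r) *\<^sub>C cblinfun_apply F (x j)) =
        inverse (of_real r) *\<^sub>C (\<Sum>j<k. \<beta> j *\<^sub>C cblinfun_apply F (x j))"
      by (simp add: complex_vector.scale_sum_right scaleC_scaleC divide_inverse mult.commute)
    also have "\<dots> = 0" by (simp add: \<beta>(3) complex_vector.scale_zero_right)
    finally show "(\<Sum>j<k. (\<beta> j / of_real r) *\<^sub>C cblinfun_apply F (x j)) = 0" .
  qed
qed

text \<open>Tychonoff's theorem. Filters replace sequences because \<open>'j\<close> may be
  uncountable, where convergent subsequences can fail to exist.\<close>

lemma pointwise_convergent_subfilter:
  fixes g :: "'i \<Rightarrow> 'j \<Rightarrow> complex"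
  assumes F: "F \<noteq> bot" and bounded: "\<And>j. eventually (\<lambda>i. cmod (g i j) \<le> b j) F"
  obtains G l where "G \<le> F" "G \<noteq> bot" "\<And>j. ((\<lambda>i. g i j) \<longlongrightarrow> l j) G"
proof -
  \<comment> \<open>The bounds hold only eventually, with a threshold depending on \<open>j\<close>.
    Truncation puts every \<open>g' i\<close> into the compact \<open>U\<close>, and each coordinate
    eventually agrees with that of \<open>g\<close>.\<close>
  define g' where "g' i j = (if cmod (g i j) \<le> b j then g i j else 0)" for i j
  define U where "U = (PiE UNIV (\<lambda>j. cball (0 :: complex) (b j)))"
  have b: "0 \<le> b j" for j
  proof -
    obtain i where "cmod (g i j) \<le> b j" using eventually_happens'[OF F bounded] by blast
    then show ?thesis by (smt (verit) norm_ge_zero)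
  qed
  have "compactin (product_topology (\<lambda>_. euclidean) UNIV) U"
    unfolding U_def by (subst compactin_PiE) simp
  then have "compact U" by (simp add: euclidean_product_topology)
  moreover have "eventually (\<lambda>f. f \<in> U) (filtermap g' F)"
    unfolding eventually_filtermap using b by (intro always_eventually allI) (auto simp: U_def g'_def)
  moreover have "filtermap g' F \<noteq> bot" using F by (simp add: filtermap_bot_iff)
  ultimately obtain l where l: "inf (nhds l) (filtermap g' F) \<noteq> bot"
    unfolding compact_filter by blast
  \<comment> \<open>Restricts \<open>F\<close> to indices at which \<open>g'\<close> is near the
    cluster point \<open>l\<close>.\<close>
  define G where "G = inf (filtercomap g' (nhds l)) F"
  have GF: "G \<le> F" by (simp add: G_def)
  have "G \<noteq> bot"
  proof
    assume "G = bot"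
    then have "eventually (\<lambda>_. False) G" by simp
    then obtain Q R where QR: "eventually Q (filtercomap g' (nhds l))" "eventually R F"
      "\<And>i. Q i \<Longrightarrow> R i \<Longrightarrow> False"
      unfolding G_def eventually_inf by blast
    then obtain Q' where Q': "eventually Q' (nhds l)" "\<And>i. Q' (g' i) \<Longrightarrow> Q i"
      unfolding eventually_filtercomap by blast
    have "eventually (\<lambda>f. \<not> Q' f) (filtermap g' F)"
      unfolding eventually_filtermap using QR(2) by eventually_elim (use QR Q' in blast)
    with Q'(1) have "eventually (\<lambda>_. False) (inf (nhds l) (filtermap g' F))"
      unfolding eventually_inf by blast
    with l show False by (simp add: trivial_limit_def)
  qed
  have "((\<lambda>i. g i j) \<longlongrightarrow> l j) G" for j
  proof -
    have g': "(g' \<longlongrightarrow> l) G"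
      unfolding G_def by (rule filterlim_mono[OF filterlim_filtercomap order_refl inf_le1])
    have "((\<lambda>i. g' i j) \<longlongrightarrow> l j) G"
    proof (rule topological_tendstoI)
      fix V assume V: "open V" "l j \<in> V"
      have "open ((\<lambda>f :: 'j \<Rightarrow> complex. f j) -` V)"
        using V(1) by (rule open_vimage) (rule continuous_on_product_coordinates)
      from topological_tendstoD[OF g' this] V(2)
      show "eventually (\<lambda>i. g' i j \<in> V) G" by simp
    qed
    moreover have "eventually (\<lambda>i. g' i j = g i j) G"
      using filter_leD[OF GF bounded[of j]] by eventually_elim (simp add: g'_def)
    ultimately show ?thesis by (rule Lim_transform_eventually)
  qed
  from GF \<open>G \<noteq> bot\<close> this show thesis by (rule that)
qed

text \<open>Approximants for growing finite data converge coordinatewise along a filter. The error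
  bound and the dependence relations of \<open>finite_rank_less_iff\<close> survive, so the limit is
  an admissible approximant.\<close>

lemma approx_number_le_of_finite_data:
  fixes A :: "'a::complex_normed_vector \<Rightarrow>\<^sub>C\<^sub>L ell2"
  assumes c: "0 \<le> c" and approx: "\<And>E m \<epsilon>. finite E \<Longrightarrow> \<epsilon> > 0 \<Longrightarrow> \<exists>F\<in>finite_rank_less k. \<forall>x\<in>E.
    L2_set (\<lambda>i. cmod (ell2_nth (cblinfun_apply F x) i - ell2_nth (cblinfun_apply A x) i)) {..<m}
      \<le> c * norm x + \<epsilon>"
  shows "approx_number k A \<le> c"
proof -
  define err where "err y x n = L2_set (\<lambda>i. cmod (y i - ell2_nth (cblinfun_apply A x) i)) {..<n}" for y x n
  have err_mono: "err y x n \<le> err y x m" if "n \<le> m" for y x and n m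
    unfolding err_def L2_set_def using that by (intro real_sqrt_le_mono sum_mono2) auto
  \<comment> \<open>The number of coordinates also sets the tolerance. Infinite sets impose no
    condition, so that \<open>F\<close> can be chosen for every \<open>u\<close>.\<close>
  have "\<exists>F\<in>finite_rank_less k. finite (fst u) \<longrightarrow> (\<forall>x\<in>fst u.
      err (ell2_nth (cblinfun_apply F x)) x (snd u) \<le> c * norm x + inverse (real (Suc (snd u))))"
    for u :: "'a set \<times> nat"
  proof (cases "finite (fst u)")
    case True
    from approx[OF this, of "inverse (real (Suc (snd u)))" "snd u"] show ?thesis by (auto simp: err_def)
  next
    case False
    then show ?thesis using approx[of "{}" 1] by auto
  qed
  then obtain F where F: "\<And>u. F u \<in> finite_rank_less k"
    and F_err: "\<And>u x. finite (fst u) \<Longrightarrow> x \<in> fst u \<Longrightarrow>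
      err (ell2_nth (cblinfun_apply (F u) x)) x (snd u) \<le> c * norm x + inverse (real (Suc (snd u)))"
    by metis
  define \<F> :: "('a set \<times> nat) filter" where "\<F> = finite_subsets_at_top UNIV \<times>\<^sub>F sequentially"
  have \<F>: "\<F> \<noteq> bot" by (simp add: \<F>_def prod_filter_eq_bot)
  have ev: "eventually (\<lambda>u. err (ell2_nth (cblinfun_apply (F u) x)) x n \<le> c * norm x + \<epsilon>) \<F>"
    if "\<epsilon> > 0" for x n \<epsilon>
  proof -
    have "eventually (\<lambda>E. finite E \<and> x \<in> E) (finite_subsets_at_top UNIV)"
      unfolding eventually_finite_subsets_at_top by (intro exI[of _ "{x}"]) auto
    moreover have "eventually (\<lambda>m. n \<le> m \<and> inverse (real (Suc m)) < \<epsilon>) sequentially"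
    proof (rule eventually_conj)
      show "eventually (\<lambda>m. inverse (real (Suc m)) < \<epsilon>) sequentially"
        using LIMSEQ_inverse_real_of_nat that by (rule order_tendstoD)
    qed (rule eventually_ge_at_top)
    ultimately have "eventually (\<lambda>u. (finite (fst u) \<and> x \<in> fst u) \<and>
        (n \<le> snd u \<and> inverse (real (Suc (snd u))) < \<epsilon>)) \<F>"
      unfolding \<F>_def eventually_prod_filter by (fastforce simp del: of_nat_Suc)
    then show ?thesis
    proof eventually_elim
      case (elim u)
      then show ?case
        using F_err[of u x] err_mono[of n "snd u" "ell2_nth (cblinfun_apply (F u) x)" x] by linarith
    qed
  qed
  \<comment> \<open>Coordinate bounds for compactness, from tolerance 1; \<open>Suc (snd j)\<close>
    coordinates are taken so that index \<open>snd j\<close> is among them.\<close>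
  have "eventually (\<lambda>u. cmod (ell2_nth (cblinfun_apply (F u) (fst j)) (snd j))
      \<le> norm (cblinfun_apply A (fst j)) + (c * norm (fst j) + 1)) \<F>" for j :: "'a \<times> nat"
    using ev[of 1 "fst j" "Suc (snd j)", OF zero_less_one]
  proof eventually_elim
    case (elim u)
    have "cmod (ell2_nth (cblinfun_apply (F u) (fst j)) (snd j) - ell2_nth (cblinfun_apply A (fst j)) (snd j))
        \<le> err (ell2_nth (cblinfun_apply (F u) (fst j))) (fst j) (Suc (snd j))"
      unfolding err_def by (rule member_le_L2_set) auto
    moreover have "cmod (ell2_nth (cblinfun_apply A (fst j)) (snd j)) \<le> norm (cblinfun_apply A (fst j))"
      using L2_set_ell2_le[of "{snd j}" "cblinfun_apply A (fst j)"] by simp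
    ultimately show ?case
      using elim norm_triangle_sub[of "ell2_nth (cblinfun_apply (F u) (fst j)) (snd j)"
          "ell2_nth (cblinfun_apply A (fst j)) (snd j)"] by linarith
  qed
  from pointwise_convergent_subfilter[of \<F> "\<lambda>u j. ell2_nth (cblinfun_apply (F u) (fst j)) (snd j)", OF \<F> this]
  obtain \<G> l where \<G>: "\<G> \<le> \<F>" "\<G> \<noteq> bot"
    and "\<And>j. ((\<lambda>u. ell2_nth (cblinfun_apply (F u) (fst j)) (snd j)) \<longlongrightarrow> l j) \<G>"
    by auto
  then have lim: "((\<lambda>u. ell2_nth (cblinfun_apply (F u) x) i) \<longlongrightarrow> l (x, i)) \<G>" for x i
    by (metis fst_conv snd_conv)
  have "err (\<lambda>i. l (x, i)) x n \<le> c * norm x" for x n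
  proof (rule field_le_epsilon)
    fix \<epsilon> :: real assume "\<epsilon> > 0"
    have "((\<lambda>u. err (ell2_nth (cblinfun_apply (F u) x)) x n) \<longlongrightarrow> err (\<lambda>i. l (x, i)) x n) \<G>"
      unfolding err_def L2_set_def by (intro tendsto_intros lim)
    then show "err (\<lambda>i. l (x, i)) x n \<le> c * norm x + \<epsilon>"
      using filter_leD[OF \<G>(1) ev[OF \<open>\<epsilon> > 0\<close>]] \<G>(2) by (rule tendsto_upperbound)
  qed
  then have "\<exists>y. ell2_nth y = (\<lambda>i. l (x, i) - ell2_nth (cblinfun_apply A x) i) \<and> norm y \<le> c * norm x" for x
    unfolding err_def
    using ell2_of_bounded_L2[of "\<lambda>i. l (x, i) - ell2_nth (cblinfun_apply A x) i" "c * norm x"] by metis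
  \<comment> \<open>The deviation from \<open>A\<close> is built rather than the limit: it carries
    the bound \<open>c * norm x\<close>, and the limit operator is then
    \<open>A + D\<close>.\<close>
  then obtain d where d: "\<And>x. ell2_nth (d x) = (\<lambda>i. l (x, i) - ell2_nth (cblinfun_apply A x) i)"
    "\<And>x. norm (d x) \<le> c * norm x"
    by metis
  have l_add: "l (x + y, i) = l (x, i) + l (y, i)" for x y i
    using tendsto_unique[OF \<G>(2) lim[of "x + y" i]] tendsto_add[OF lim lim, of x i y i]
    by (simp add: linear_add[OF linear_cblinfun_apply] ell2_nth_add)
  have l_scale: "l (a *\<^sub>C x, i) = a * l (x, i)" for a x i
    using tendsto_unique[OF \<G>(2) lim[of "a *\<^sub>C x" i]] tendsto_mult_left[OF lim[of x i], of a]
    by (simp add: cblinfun_apply_scaleC ell2_nth_scaleC)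
  obtain D where D: "cblinfun_apply D = d" "norm D \<le> c"
  proof (rule cblinfun_of_linear[of d c])
    show "d (x + y) = d x + d y" for x y
      by (rule ell2_eqI)
        (simp add: d ell2_nth_add l_add linear_add[OF linear_cblinfun_apply])
    show "d (a *\<^sub>C x) = a *\<^sub>C d x" for a x
      by (rule ell2_eqI) (simp add: d ell2_nth_scaleC l_scale cblinfun_apply_scaleC right_diff_distrib)
  qed (simp_all add: d c)
  have nth: "ell2_nth (cblinfun_apply (A + D) x) i = l (x, i)" for x i
    by (simp add: cblinfun_apply_plus D d ell2_nth_add)
  have "A + D \<in> finite_rank_less k"
    unfolding finite_rank_less_iff
  proof
    fix x :: "nat \<Rightarrow> 'a"
    have "\<exists>\<alpha>. (\<Sum>j<k. cmod (\<alpha> j)) = 1 \<and> (\<Sum>j<k. \<alpha> j *\<^sub>C cblinfun_apply (F u) (x j)) = 0" for u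
      using finite_rank_less_normalized[OF F] by metis
    then obtain \<alpha> where \<alpha>: "\<And>u. (\<Sum>j<k. cmod (\<alpha> u j)) = 1"
      "\<And>u. (\<Sum>j<k. \<alpha> u j *\<^sub>C cblinfun_apply (F u) (x j)) = 0"
      by metis
    have "cmod (if j < k then \<alpha> u j else 0) \<le> 1" for u j
      using member_le_sum[of j "{..<k}" "\<lambda>j. cmod (\<alpha> u j)"] \<alpha>(1)[of u] by auto
    then have "eventually (\<lambda>u. cmod (if j < k then \<alpha> u j else 0) \<le> 1) \<G>" for j
      by simp
    \<comment> \<open>A second subfilter, as the coefficients vary with \<open>u\<close>. The value
      0 from \<open>k\<close> on makes the bound 1 hold at every index.\<close>
    then obtain \<H> \<beta> where \<H>: "\<H> \<le> \<G>" "\<H> \<noteq> bot"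
      and cut: "\<And>j. ((\<lambda>u. if j < k then \<alpha> u j else 0) \<longlongrightarrow> \<beta> j) \<H>"
      by (rule pointwise_convergent_subfilter[OF \<G>(2),
            where g = "\<lambda>u j. if j < k then \<alpha> u j else 0" and b = "\<lambda>_. 1"]) (rule that)
    have \<beta>: "((\<lambda>u. \<alpha> u j) \<longlongrightarrow> \<beta> j) \<H>" if "j < k" for j
      using cut[of j] that by simp
    have "((\<lambda>u. \<Sum>j<k. cmod (\<alpha> u j)) \<longlongrightarrow> (\<Sum>j<k. cmod (\<beta> j))) \<H>"
      using \<beta> by (intro tendsto_sum tendsto_norm) auto
    then have "(\<Sum>j<k. cmod (\<beta> j)) = 1"
      unfolding \<alpha>(1) using tendsto_unique[OF \<H>(2) tendsto_const] by metis
    then have "\<exists>j<k. \<beta> j \<noteq> 0"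
      by (metis lessThan_iff norm_zero sum.neutral zero_neq_one)
    moreover have "(\<Sum>j<k. \<beta> j *\<^sub>C cblinfun_apply (A + D) (x j)) = 0"
    proof (rule ell2_eqI)
      fix i
      have "((\<lambda>u. \<Sum>j<k. \<alpha> u j * ell2_nth (cblinfun_apply (F u) (x j)) i) \<longlongrightarrow>
          (\<Sum>j<k. \<beta> j * l (x j, i))) \<H>"
        using \<beta> tendsto_mono[OF \<H>(1) lim] by (intro tendsto_sum tendsto_mult) auto
      moreover have "(\<Sum>j<k. \<alpha> u j * ell2_nth (cblinfun_apply (F u) (x j)) i) = 0" for u
        using arg_cong[OF \<alpha>(2)[of u], of "\<lambda>y. ell2_nth y i"]
        by (simp add: ell2_nth_sum ell2_nth_scaleC ell2_nth_0)
      ultimately have "((\<lambda>_. 0) \<longlongrightarrow> (\<Sum>j<k. \<beta> j * l (x j, i))) \<H>" by simp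
      then have "(\<Sum>j<k. \<beta> j * l (x j, i)) = 0"
        using tendsto_unique[OF \<H>(2) tendsto_const] by metis
      then show "ell2_nth (\<Sum>j<k. \<beta> j *\<^sub>C cblinfun_apply (A + D) (x j)) i = ell2_nth 0 i"
        by (simp add: ell2_nth_sum ell2_nth_scaleC ell2_nth_0 nth)
    qed
    ultimately show "\<exists>\<beta>. (\<exists>j<k. \<beta> j \<noteq> 0) \<and> (\<Sum>j<k. \<beta> j *\<^sub>C cblinfun_apply (A + D) (x j)) = 0"
      by blast
  qed
  then have "approx_number k A \<le> norm (A - (A + D))"
    unfolding approx_number_def by (intro cINF_lower) (auto intro: bdd_belowI[of _ 0])
  also have "\<dots> \<le> c" using D(2) by simp
  finally show ?thesis .
qed

section \<open>Chang numbers\<close>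

lemma approx_number_lessE:
  fixes A :: "'a::complex_normed_vector \<Rightarrow>\<^sub>C\<^sub>L 'b::complex_normed_vector"
  assumes "k \<ge> 1" "approx_number k A < c"
  obtains F where "F \<in> finite_rank_less k" "norm (A - F) < c"
proof -
  have "(\<lambda>F. norm (A - F)) ` finite_rank_less k \<noteq> {}"
    using zero_in_finite_rank_less[OF assms(1)] by auto
  from cInf_lessD[OF this] assms(2) show thesis
    using that by (auto simp: approx_number_def)
qed

lemma approx_number_compose_le:
  fixes A :: "'b::complex_normed_vector \<Rightarrow>\<^sub>C\<^sub>L 'c::complex_normed_vector"
    and P :: "'a::complex_normed_vector \<Rightarrow>\<^sub>C\<^sub>L 'b"
  assumes k: "k \<ge> 1" and P: "norm P \<le> 1"
  shows "approx_number k (A o\<^sub>C P) \<le> approx_number k A"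
  unfolding approx_number_def[of k A]
proof (rule cINF_greatest)
  show "finite_rank_less k \<noteq> {}" using zero_in_finite_rank_less[OF k] by auto
  fix F :: "'b \<Rightarrow>\<^sub>C\<^sub>L 'c" assume F: "F \<in> finite_rank_less k"
  have "approx_number k (A o\<^sub>C P) \<le> norm ((A o\<^sub>C P) - (F o\<^sub>C P))"
    unfolding approx_number_def using finite_rank_less_compose[OF F]
    by (intro cINF_lower) (auto intro: bdd_belowI[of _ 0])
  also have "(A o\<^sub>C P) - (F o\<^sub>C P) = (A - F) o\<^sub>C P"
    by (rule cblinfun_eqI) (simp add: cblinfun_apply_minus)
  also have "norm \<dots> \<le> norm (A - F) * norm P" by (rule norm_cblinfun_compose)
  also have "\<dots> \<le> norm (A - F)" using P by (simp add: mult_left_le)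
  finally show "approx_number k (A o\<^sub>C P) \<le> norm (A - F)" .
qed

lemma cblinfun_compose_assoc: "(S o\<^sub>C T) o\<^sub>C P = S o\<^sub>C (T o\<^sub>C P)"
  by (rule cblinfun_eqI) simp

text \<open>Holds for each competing \<open>S\<close> separately by
  \<open>approx_number_compose_le\<close>. This is the upper half of the limit.\<close>

lemma chang_number_compose_le:
  fixes T :: "'b::complex_normed_vector \<Rightarrow>\<^sub>C\<^sub>L 'c::complex_normed_vector"
    and P :: "'a::complex_normed_vector \<Rightarrow>\<^sub>C\<^sub>L 'b"
  assumes k: "k \<ge> 1" and P: "norm P \<le> 1"
  shows "chang_number k (T o\<^sub>C P) \<le> chang_number k T"
  unfolding chang_number_def[of k "T o\<^sub>C P"]
proof (rule cSUP_least)
  show "{S :: 'c \<Rightarrow>\<^sub>C\<^sub>L ell2. norm S \<le> 1} \<noteq> {}" by (auto intro: exI[of _ 0])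
  fix S :: "'c \<Rightarrow>\<^sub>C\<^sub>L ell2" assume S: "S \<in> {S. norm S \<le> 1}"
  have "approx_number k (S o\<^sub>C (T o\<^sub>C P)) \<le> approx_number k (S o\<^sub>C T)"
    using approx_number_compose_le[OF k P, of "S o\<^sub>C T"] by (simp add: cblinfun_compose_assoc)
  also have "\<dots> \<le> chang_number k T"
    unfolding chang_number_def by (rule cSUP_upper[OF S bdd_above_chang_number[OF k]])
  finally show "approx_number k (S o\<^sub>C (T o\<^sub>C P)) \<le> chang_number k T" .
qed

lemma chang_number_nonneg:
  fixes T :: "'a::complex_normed_vector \<Rightarrow>\<^sub>C\<^sub>L 'b::complex_normed_vector"
  assumes k: "k \<ge> 1"
  shows "0 \<le> chang_number k T"
proof -
  have "0 \<le> approx_number k ((0 :: 'b \<Rightarrow>\<^sub>C\<^sub>L ell2) o\<^sub>C T)" by (rule approx_number_nonneg[OF k])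
  also have "\<dots> \<le> chang_number k T"
    unfolding chang_number_def by (rule cSUP_upper[OF _ bdd_above_chang_number[OF k]]) simp
  finally show ?thesis .
qed

text \<open>Lower semicontinuity. Each finite set of data needs just one \<open>n\<close> at which
  the bound on \<open>Q n\<close> and weak-star closeness hold together, so a frequent bound
  suffices.\<close>

lemma chang_number_le_of_frequently:
  fixes T :: "'x::complex_normed_vector \<Rightarrow>\<^sub>C\<^sub>L 'z::complex_normed_vector dual"
    and Q :: "nat \<Rightarrow> 'x \<Rightarrow>\<^sub>C\<^sub>L 'z dual"
  assumes k: "k \<ge> 1" and Q: "weak_star_convergent Q T" and c: "0 \<le> c"
    and freq: "\<exists>\<^sub>F n in sequentially. chang_number k (Q n) < c"
  shows "chang_number k T \<le> c"
  unfolding chang_number_def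
proof (rule cSUP_least)
  show "{S :: 'z dual \<Rightarrow>\<^sub>C\<^sub>L ell2. norm S \<le> 1} \<noteq> {}" by (auto intro: exI[of _ 0])
  fix S :: "'z dual \<Rightarrow>\<^sub>C\<^sub>L ell2" assume "S \<in> {S. norm S \<le> 1}"
  then have S: "norm S \<le> 1" by simp
  show "approx_number k (S o\<^sub>C T) \<le> c"
  proof (rule approx_number_le_of_finite_data[OF c])
    fix E :: "'x set" and m :: nat and \<epsilon> :: real
    assume E: "finite E" and \<epsilon>: "\<epsilon> > 0"
    \<comment> \<open>Two errors \<open>\<delta>\<close> per coordinate: one from replacing
      \<open>S\<close> by evaluations, one from replacing \<open>T\<close> by
      \<open>Q n\<close>.\<close>
    define \<delta> where "\<delta> = \<epsilon> / (2 * (real m + 1))"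
    have \<delta>: "\<delta> > 0" "real m * (2 * \<delta>) \<le> \<epsilon>" using \<epsilon> by (simp_all add: \<delta>_def field_simps)
    obtain z :: "nat \<Rightarrow> 'z"
      where z: "\<And>\<phi>. L2_set (\<lambda>i. cmod (cblinfun_apply \<phi> (z i))) {..<m} \<le> norm \<phi>"
        "\<And>\<phi> i. \<phi> \<in> cblinfun_apply T ` E \<Longrightarrow> i < m \<Longrightarrow>
          cmod (cblinfun_apply \<phi> (z i) - ell2_nth (cblinfun_apply S \<phi>) i) \<le> \<delta>"
      by (rule goldstine_operator[OF S finite_imageI[OF E] \<delta>(1)]) blast
    obtain R :: "'z dual \<Rightarrow>\<^sub>C\<^sub>L ell2" where R: "norm R \<le> 1"
      "\<And>\<phi> i. i < m \<Longrightarrow> ell2_nth (cblinfun_apply R \<phi>) i = cblinfun_apply \<phi> (z i)"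
      by (rule evaluation_operator[OF z(1)]) blast
    have ev: "\<forall>\<^sub>F n in sequentially. \<forall>(x, i)\<in>E \<times> {..<m}.
        cmod (cblinfun_apply (cblinfun_apply (Q n) x) (z i) - cblinfun_apply (cblinfun_apply T x) (z i)) < \<delta>"
    proof (rule eventually_ball_finite)
      show "\<forall>j\<in>E \<times> {..<m}. \<forall>\<^sub>F n in sequentially. case j of (x, i) \<Rightarrow>
          cmod (cblinfun_apply (cblinfun_apply (Q n) x) (z i) - cblinfun_apply (cblinfun_apply T x) (z i)) < \<delta>"
        using order_tendstoD(2)[OF Q[unfolded weak_star_convergent_def, rule_format] \<delta>(1)] by simp
    qed (use E in simp)
    have "\<exists>\<^sub>F n in sequentially. chang_number k (Q n) < c \<and> (\<forall>(x, i)\<in>E \<times> {..<m}.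
        cmod (cblinfun_apply (cblinfun_apply (Q n) x) (z i) - cblinfun_apply (cblinfun_apply T x) (z i)) < \<delta>)"
      using freq by (rule frequently_rev_mp) (use ev in \<open>eventually_elim, blast\<close>)
    then obtain n where n: "chang_number k (Q n) < c" "\<And>x i. x \<in> E \<Longrightarrow> i < m \<Longrightarrow>
        cmod (cblinfun_apply (cblinfun_apply (Q n) x) (z i) - cblinfun_apply (cblinfun_apply T x) (z i)) < \<delta>"
      using frequently_ex by fastforce
    \<comment> \<open>As a contraction \<open>R\<close> competes in the supremum, so the bound on
      the Chang number supplies the approximant \<open>F\<close>.\<close>
    have "approx_number k (R o\<^sub>C Q n) \<le> chang_number k (Q n)"
      unfolding chang_number_def using R(1) by (intro cSUP_upper[OF _ bdd_above_chang_number[OF k]]) simp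
    with n(1) obtain F where F: "F \<in> finite_rank_less k" "norm ((R o\<^sub>C Q n) - F) < c"
      using approx_number_lessE[OF k] by (metis order_le_less_trans)
    have "L2_set (\<lambda>i. cmod (ell2_nth (cblinfun_apply F x) i - ell2_nth (cblinfun_apply (S o\<^sub>C T) x) i)) {..<m}
        \<le> c * norm x + \<epsilon>" if x: "x \<in> E" for x
    proof -
      define y where "y = cblinfun_apply ((R o\<^sub>C Q n) - F) x"
      have y: "norm y \<le> c * norm x"
        unfolding y_def using F(2) by (intro order_trans[OF norm_cblinfun_apply] mult_right_mono) auto
      have split: "cmod (ell2_nth (cblinfun_apply F x) i - ell2_nth (cblinfun_apply (S o\<^sub>C T) x) i)
          \<le> cmod (ell2_nth y i) + 2 * \<delta>" if i: "i < m" for i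
      proof -
        define a where "a = cblinfun_apply (cblinfun_apply (Q n) x) (z i)"
        define b where "b = cblinfun_apply (cblinfun_apply T x) (z i)"
        define s where "s = ell2_nth (cblinfun_apply S (cblinfun_apply T x)) i"
        have "cmod (a - b) < \<delta>" "cmod (b - s) \<le> \<delta>"
          using n(2)[OF x i] z(2)[of "cblinfun_apply T x" i] x i by (auto simp: a_def b_def s_def)
        moreover have "ell2_nth (cblinfun_apply F x) i = a - ell2_nth y i"
          using R(2)[OF i] by (simp add: y_def a_def cblinfun_apply_minus ell2_nth_diff)
        moreover have "cmod (a - ell2_nth y i - s) \<le> cmod (ell2_nth y i) + cmod (a - b) + cmod (b - s)"
          using norm_triangle_ineq4[of "a - s" "ell2_nth y i"] norm_triangle_ineq[of "a - b" "b - s"]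
          by (simp add: algebra_simps)
        ultimately show ?thesis by (simp add: s_def)
      qed
      have "L2_set (\<lambda>i. cmod (ell2_nth (cblinfun_apply F x) i - ell2_nth (cblinfun_apply (S o\<^sub>C T) x) i)) {..<m}
          \<le> L2_set (\<lambda>i. cmod (ell2_nth y i) + 2 * \<delta>) {..<m}"
        using split by (intro L2_set_mono) auto
      also have "\<dots> \<le> L2_set (\<lambda>i. cmod (ell2_nth y i)) {..<m} + L2_set (\<lambda>i. 2 * \<delta>) {..<m}"
        by (rule L2_set_triangle_ineq)
      also have "\<dots> \<le> c * norm x + (\<Sum>i<m. 2 * \<delta>)"
        using \<delta>(1) y L2_set_ell2_le[of "{..<m}" y] L2_set_le_sum[of "{..<m}" "\<lambda>_. 2 * \<delta>"]
        by (intro add_mono) auto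
      also have "\<dots> \<le> c * norm x + \<epsilon>" using \<delta>(2) by simp
      finally show ?thesis .
    qed
    with F(1) show "\<exists>F\<in>finite_rank_less k. \<forall>x\<in>E. L2_set (\<lambda>i. cmod (ell2_nth (cblinfun_apply F x) i
        - ell2_nth (cblinfun_apply (S o\<^sub>C T) x) i)) {..<m} \<le> c * norm x + \<epsilon>"
      by blast
  qed
qed

theorem theorem7:
  fixes T :: "'x::complex_banach \<Rightarrow>\<^sub>C\<^sub>L 'z::complex_normed_vector dual"
    and P :: "nat \<Rightarrow> 'x \<Rightarrow>\<^sub>C\<^sub>L 'x"
    and k :: nat
  assumes "\<not> finite_cdim (UNIV :: 'x set)"
    and "\<not> finite_cdim (UNIV :: 'z dual set)"
    and "\<And>n. n \<ge> 1 \<Longrightarrow> norm (P n) \<le> 1"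
    and "weak_star_convergent (\<lambda>n. T o\<^sub>C P n) T"
    and "k \<ge> 1"
  shows "(\<lambda>n. chang_number k (T o\<^sub>C P n)) \<longlonglongrightarrow> chang_number k T"
proof (rule order_tendstoI)
  fix c assume c: "chang_number k T < c"
  have "\<forall>\<^sub>F n in sequentially. n \<ge> 1" by (rule eventually_ge_at_top)
  then show "\<forall>\<^sub>F n in sequentially. chang_number k (T o\<^sub>C P n) < c"
  proof eventually_elim
    case (elim n)
    then show ?case
      using chang_number_compose_le[OF assms(5) assms(3), of n T] c by simp
  qed
next
  fix c assume c: "c < chang_number k T"
  \<comment> \<open>The midpoint leaves room above \<open>c\<close>; it is raised to 0 because
    \<open>chang_number_le_of_frequently\<close> asks for a nonnegative bound.\<close>
  define e where "e = max 0 ((c + chang_number k T) / 2)"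
  have e: "c < e" "0 \<le> e" using c by (auto simp: e_def less_max_iff_disj)
  show "\<forall>\<^sub>F n in sequentially. c < chang_number k (T o\<^sub>C P n)"
  proof (cases "e < chang_number k T")
    case True
    then have "\<not> (\<exists>\<^sub>F n in sequentially. chang_number k (T o\<^sub>C P n) < e)"
      using chang_number_le_of_frequently[OF assms(5,4) e(2)] by fastforce
    then show ?thesis
      unfolding not_frequently by eventually_elim (use e in simp)
  next
    case False
    \<comment> \<open>The midpoint is below the Chang number of \<open>T\<close>, so here
      \<open>e\<close> is 0 and that Chang number vanishes.\<close>
    then have "c < 0"
      using c chang_number_nonneg[OF assms(5), of T] by (auto simp: e_def)
    then show ?thesis
      using chang_number_nonneg[OF assms(5)] by (intro always_eventually) (auto intro: less_le_trans)
  qed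
qed

end
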